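(* Let $I>0$ and $p>0$ be fixed. For $0<r<R$ with $R$ sufficiently small, let $\Gamma$ be the family of curves in the annulus $A=\{z\in\mathbb{C}:r<|z|<R\}$ joining its inner and outer boundary. In each formula below, $o(1)$ denotes a quantity which, for fixed $\psi$ and $I$ (hence fixed $p,\alpha,\beta$), tends to $0$ as $R\to0$, uniformly in $r\in(0,R)$. (i) Let $\psi(x)=e^{px^\alpha}$ with $\alpha\ge 1$. If $\alpha=1$, then $$M_{\psi,I}(\Gamma)=2\pi\Bigl(o(1)+\frac p2\bigl(\log\log(r^{-1})-\log\log(R^{-1})\bigr)\Bigr)^{-1},$$ and if $\alpha>1$, then $$M_{\psi,I}(\Gamma)=2\pi\Bigl(o(1)+\Bigl(\frac p2\Bigr)^{1/\alpha}\frac{\alpha}{\alpha-1}\bigl(\log^{(\alpha-1)/\alpha}(r^{-1})-\log^{(\alpha-1)/\alpha}(R^{-1})\bigr)\Bigr)^{-1}.$$ (ii) Let $\psi(x)=e^{px/\log^\beta(x)}$ with $\beta\in(0,1]$. If $\beta=1$, then $$M_{\psi,I}(\Gamma)=2\pi\Bigl(o(1)+\frac p2\bigl(\log\log\log(r^{-1})-\log\log\log(R^{-1})\bigr)\Bigr)^{-1},$$ and if $\beta\in(0,1)$, then $$M_{\psi,I}(\Gamma)=2\pi\Bigl(o(1)+\frac{p}{2(1-\beta)}\bigl((\log\log(1/r))^{1-\beta}-(\log\log(1/R))^{1-\beta}\bigr)\Bigr)^{-1}.$$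
   Context: Weighted modulus: for a path family $\Gamma$, a Borel function $\rho:\mathbb{C}\to[0,\infty]$ is admissible if $\int_\gamma\rho\,|dz|\ge 1$ for every locally rectifiable $\gamma\in\Gamma$; for a measurable weight $\omega\ge 0$ set $M_\omega(\Gamma)=\inf_{\rho\text{ admissible}}\int\rho^2\omega\,dA$. Conditional modulus: for the family $\Gamma$ of curves joining the boundary components of the annulus $A$ inside $A$, $M_{\psi,I}(\Gamma)$ is the supremum of $M_K(\Gamma)$ over all measurable functions $K\ge 1$ on $A$ satisfying $\int_A\psi(K)\,dA\le I$. In (ii), $\psi$ is given by the formula for $x>1$, with the convention $\psi(1)=+\infty$. (In these examples $\psi$ does not vanish at $1$; the definition of $M_{\psi,I}$ is applied to $\psi$ as given.) *)

theory Defs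
  imports "HOL-Analysis.Analysis"
begin

text \<open>
  A curve is a function on the reals of which only the restriction to the open parameter
  interval \<open>{0<..<1}\<close> matters; it may have infinite length near the end points.
\<close>

definition arc_length :: "(real \<Rightarrow> complex) \<Rightarrow> real \<Rightarrow> real \<Rightarrow> ennreal" where
  "arc_length \<gamma> a b =
     (SUP (n, t) \<in> {(n :: nat, t :: nat \<Rightarrow> real). mono_on {..n} t \<and> t ` {..n} \<subseteq> {a..b}}.
        \<Sum>i<n. ennreal (dist (\<gamma> (t i)) (\<gamma> (t (Suc i)))))"

definition locally_rectifiable :: "(real \<Rightarrow> complex) \<Rightarrow> bool" where
  "locally_rectifiable \<gamma> \<longleftrightarrow> (\<forall>a b. 0 < a \<and> a \<le> b \<and> b < 1 \<longrightarrow> arc_length \<gamma> a b < \<infinity>)"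

text \<open>
  On a compact subinterval \<open>{a..b}\<close> the integral of \<open>\<rho>\<close> with respect to \<open>|dz|\<close> is the integral
  of \<open>\<rho> \<circ> \<gamma>\<close> against the Lebesgue--Stieltjes measure of the arc length function. That function is
  constant outside \<open>{a..b}\<close> and, for a continuous locally rectifiable curve, finite,
  nondecreasing and continuous.
\<close>

definition line_integral_on ::
    "(complex \<Rightarrow> ennreal) \<Rightarrow> (real \<Rightarrow> complex) \<Rightarrow> real \<Rightarrow> real \<Rightarrow> ennreal" where
  "line_integral_on \<rho> \<gamma> a b =
     (\<integral>\<^sup>+t\<in>{a..b}. \<rho> (\<gamma> t) \<partial>interval_measure (\<lambda>t. enn2real (arc_length \<gamma> a (min b t))))"

definition line_integral :: "(complex \<Rightarrow> ennreal) \<Rightarrow> (real \<Rightarrow> complex) \<Rightarrow> ennreal" where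
  "line_integral \<rho> \<gamma> = (SUP (a, b) \<in> {(a, b). 0 < a \<and> a \<le> b \<and> b < 1}. line_integral_on \<rho> \<gamma> a b)"

definition admissible :: "(real \<Rightarrow> complex) set \<Rightarrow> (complex \<Rightarrow> ennreal) \<Rightarrow> bool" where
  "admissible \<Gamma> \<rho> \<longleftrightarrow>
     \<rho> \<in> borel_measurable borel \<and> (\<forall>\<gamma>\<in>\<Gamma>. locally_rectifiable \<gamma> \<longrightarrow> 1 \<le> line_integral \<rho> \<gamma>)"

definition weighted_modulus :: "(complex \<Rightarrow> ennreal) \<Rightarrow> (real \<Rightarrow> complex) set \<Rightarrow> ennreal" where
  "weighted_modulus \<omega> \<Gamma> = (INF \<rho>\<in>{\<rho>. admissible \<Gamma> \<rho>}. \<integral>\<^sup>+z. (\<rho> z)\<^sup>2 * \<omega> z \<partial>lebesgue)"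

text \<open>
  A weight \<open>K\<close> given on \<open>A\<close> is extended by zero; for curves inside \<open>A\<close> the choice of extension
  is immaterial, since \<open>\<rho>\<close> may be replaced by zero off \<open>A\<close>. The function \<open>\<psi>\<close> is only evaluated
  on \<open>{1..}\<close> and may take the value \<open>\<infinity>\<close>.
\<close>

definition conditional_modulus ::
    "(real \<Rightarrow> ennreal) \<Rightarrow> real \<Rightarrow> complex set \<Rightarrow> (real \<Rightarrow> complex) set \<Rightarrow> ennreal" where
  "conditional_modulus \<psi> I A \<Gamma> =
     (SUP K\<in>{K :: complex \<Rightarrow> real. K \<in> borel_measurable (lebesgue_on A) \<and> (\<forall>z\<in>A. 1 \<le> K z) \<and>
               (\<integral>\<^sup>+z\<in>A. \<psi> (K z) \<partial>lebesgue) \<le> ennreal I}.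
        weighted_modulus (\<lambda>z. ennreal (K z) * indicator A z) \<Gamma>)"

definition annulus :: "real \<Rightarrow> real \<Rightarrow> complex set" where
  "annulus r R = {z. r < cmod z \<and> cmod z < R}"

definition joining_curves :: "real \<Rightarrow> real \<Rightarrow> (real \<Rightarrow> complex) set" where
  "joining_curves r R =
     {\<gamma>. continuous_on {0<..<1} \<gamma> \<and> \<gamma> ` {0<..<1} \<subseteq> annulus r R \<and>
         (\<exists>u v. (\<gamma> \<longlongrightarrow> u) (at_right 0) \<and> (\<gamma> \<longlongrightarrow> v) (at_left 1) \<and>
                (cmod u = r \<and> cmod v = R \<or> cmod u = R \<and> cmod v = r))}"

definition psi_power :: "real \<Rightarrow> real \<Rightarrow> real \<Rightarrow> ennreal" where
  "psi_power p \<alpha> x = ennreal (exp (p * x powr \<alpha>))"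

definition psi_log :: "real \<Rightarrow> real \<Rightarrow> real \<Rightarrow> ennreal" where
  "psi_log p \<beta> x = (if 1 < x then ennreal (exp (p * x / (ln x) powr \<beta>)) else \<infinity>)"

text \<open>
  The conditional modulus equals \<open>2 \<pi> / (o(1) + L r R)\<close> for all sufficiently small \<open>R\<close>, where
  the error term \<open>o(1)\<close> tends to zero as \<open>R \<rightarrow> 0\<close>, uniformly in \<open>r\<close>. Positivity of the
  denominator is required so that the convention \<open>x / 0 = 0\<close> and the truncation of negative
  numbers by \<^const>\<open>ennreal\<close> play no role.
\<close>

definition modulus_asymptotics ::
    "(real \<Rightarrow> ennreal) \<Rightarrow> real \<Rightarrow> (real \<Rightarrow> real \<Rightarrow> real) \<Rightarrow> bool" where
  "modulus_asymptotics \<psi> I L \<longleftrightarrow>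
     (\<exists>err :: real \<Rightarrow> real \<Rightarrow> real.
        (\<forall>\<epsilon>>0. \<exists>\<delta>>0. \<forall>r R. 0 < r \<and> r < R \<and> R < \<delta> \<longrightarrow> \<bar>err r R\<bar> < \<epsilon>) \<and>
        (\<exists>R\<^sub>0>0. \<forall>r R. 0 < r \<and> r < R \<and> R < R\<^sub>0 \<longrightarrow>
           0 < err r R + L r R \<and>
           conditional_modulus \<psi> I (annulus r R) (joining_curves r R) =
             ennreal (2 * pi / (err r R + L r R))))"

end

theory Submission
  imports Defs "HOL-Real_Asymp.Real_Asymp"
begin

text \<open>
  In the coordinate \<open>x = ln (1 / |z|)\<close> a radial weight \<open>K = 1 / h x\<close> has modulus \<open>2 \<pi> / N\<close>, where
  \<open>N\<close> is the integral of \<open>h\<close> over \<open>ln (1 / R) \<le> x \<le> ln (1 / r)\<close>. Choosing \<open>h\<close> with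
  \<open>\<psi> (1 / h x) \<le> exp (2 x) / x\<^sup>2\<close>, which is integrable near the origin, bounds the conditional
  modulus from below. For the upper bound, test an arbitrary \<open>K\<close> with
  \<open>\<rho> z = h x / (|z| N)\<close>. If \<open>\<psi> k \<ge> c k (h x)\<^sup>2 exp (2 x)\<close> for all \<open>k \<ge> 1 / h x\<close>, then
  \<open>K (h x)\<^sup>2 / |z|\<^sup>2 \<le> h x / |z|\<^sup>2 + \<psi> K / c\<close> pointwise, so the modulus is at most
  \<open>2 \<pi> / N + I / (c N\<^sup>2)\<close>, whose effect on \<open>2 \<pi> / M\<close> is at most \<open>I / (2 \<pi> c)\<close>. Since \<open>c\<close> may be
  taken arbitrarily large as \<open>R \<rightarrow> 0\<close>, it suffices that the primitives of the lower and the upper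
  profile \<open>h\<close> both differ from the main term by a function that vanishes at infinity.
\<close>

section \<open>Integration along rays through the origin\<close>

text \<open>The profiles come from the area element: with \<open>|z| = exp (- x)\<close> it is
  \<open>exp (- 2 * x)\<close> times \<open>dx\<close> and the angle, so the budget \<open>I\<close>
  lets \<psi>(K) grow like \<open>exp (2 * x)\<close> up to an integrable factor, and the extremal K
  should be close to the inverse of \<psi> at \<open>exp (2 * x)\<close>. As \<psi> is exponential
  or nearly so, a factor such as \<open>1 / x\<^sup>2\<close> or c shifts its logarithm only
  slightly; this is why two profiles with the same asymptotic primitive can exist at all. The two
  bounds use different curves. The lower bound tests an admissible density only on straight radial
  segments, where line integrals are ordinary integrals. The upper bound must verify one density on
  every locally rectifiable joining curve. Such a curve need not be differentiable and may have
  infinite length near its ends, so the fundamental theorem of calculus along it is obtained from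
  chord estimates and compactness.\<close>

lemma lborel_complex: "(lborel :: complex measure) = distr (lborel \<Otimes>\<^sub>M lborel) borel (\<lambda>(x, y). Complex x y)"
proof (rule lborel_eqI)
  fix l u :: complex assume le: "\<And>b. b \<in> Basis \<Longrightarrow> l \<bullet> b \<le> u \<bullet> b"
  have m: "(\<lambda>(x, y). Complex x y) \<in> borel_measurable (lborel \<Otimes>\<^sub>M lborel)"
    by (simp add: lborel_prod borel_measurable_continuous_onI case_prod_unfold Complex_eq continuous_intros)
  have "(\<lambda>(x, y). Complex x y) -` box l u \<inter> space (lborel \<Otimes>\<^sub>M lborel) = {Re l <..< Re u} \<times> {Im l <..< Im u}"
    by (auto simp: box_def Basis_complex_def inner_complex_def space_pair_measure)
  then have "emeasure (distr (lborel \<Otimes>\<^sub>M lborel) borel (\<lambda>(x, y). Complex x y)) (box l u)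
    = emeasure (lborel \<Otimes>\<^sub>M lborel) ({Re l <..< Re u} \<times> {Im l <..< Im u})"
    by (subst emeasure_distr[OF m]) auto
  also have "\<dots> = ennreal (Re u - Re l) * ennreal (Im u - Im l)"
    using le[of 1] le[of \<i>] by (subst lborel.emeasure_pair_measure_Times) (auto simp: Basis_complex_def)
  also have "\<dots> = ennreal (\<Prod>b\<in>Basis. (u - l) \<bullet> b)"
    using le[of 1] le[of \<i>] by (simp add: Basis_complex_def ennreal_mult)
  finally show "emeasure (distr (lborel \<Otimes>\<^sub>M lborel) borel (\<lambda>(x, y). Complex x y)) (box l u) =
    ennreal (\<Prod>b\<in>Basis. (u - l) \<bullet> b)" .
qed simp

lemma borel_measurable_Complex[measurable (raw)]:
  assumes [measurable]: "f \<in> borel_measurable M" "g \<in> borel_measurable M"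
  shows "(\<lambda>x. Complex (f x) (g x)) \<in> borel_measurable M"
  unfolding Complex_eq by measurable

text \<open>Rays are indexed by their slope \<open>m\<close>; negative \<open>s\<close> in \<open>s * ray m\<close> covers the left half plane.\<close>

definition ray :: "real \<Rightarrow> complex" where
  "ray m = Complex 1 m / of_real (sqrt (1 + m\<^sup>2))"

lemma norm_ray [simp]: "cmod (ray m) = 1"
proof -
  have "1 + m\<^sup>2 > 0" by (simp add: add_pos_nonneg)
  then show ?thesis by (simp add: ray_def norm_divide complex_norm)
qed

lemma borel_measurable_ray [measurable]: "ray \<in> borel_measurable borel"
  unfolding ray_def by measurable

text \<open>Slopes in place of angles reduce the change of variables to affine ones:
  \<open>y = x * m\<close> in the inner integral, Fubini, then \<open>x = k * s\<close> with
  \<open>k = 1 / sqrt (1 + m\<^sup>2)\<close>, which makes \<open>s\<close> the signed distance from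
  the origin. The two factors \<open>k\<close> give the density \<open>1 / (1 + m\<^sup>2)\<close>
  of the angle with respect to the slope.\<close>

lemma nn_integral_polar:
  fixes f :: "complex \<Rightarrow> ennreal"
  assumes [measurable]: "f \<in> borel_measurable borel"
  shows "(\<integral>\<^sup>+z. f z \<partial>lborel) =
    (\<integral>\<^sup>+m. ennreal (1 / (1 + m\<^sup>2)) * (\<integral>\<^sup>+s. ennreal \<bar>s\<bar> * f (of_real s * ray m) \<partial>lborel) \<partial>lborel)"
proof -
  have "(\<integral>\<^sup>+z. f z \<partial>lborel) = (\<integral>\<^sup>+p. f (Complex (fst p) (snd p)) \<partial>(lborel \<Otimes>\<^sub>M lborel))"
    by (subst lborel_complex, subst nn_integral_distr) (auto simp: case_prod_unfold)
  also have "\<dots> = (\<integral>\<^sup>+x. \<integral>\<^sup>+y. f (Complex x y) \<partial>lborel \<partial>lborel)"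
    by (subst lborel.nn_integral_fst[symmetric]) auto
  also have "\<dots> = (\<integral>\<^sup>+x. \<integral>\<^sup>+m. ennreal \<bar>x\<bar> * f (Complex x (x * m)) \<partial>lborel \<partial>lborel)"
  proof (rule nn_integral_cong_AE, rule AE_mp[OF AE_lborel_singleton[of 0]], intro AE_I2 impI)
    fix x :: real assume "x \<noteq> 0"
    then show "(\<integral>\<^sup>+y. f (Complex x y) \<partial>lborel) = (\<integral>\<^sup>+m. ennreal \<bar>x\<bar> * f (Complex x (x * m)) \<partial>lborel)"
      by (subst nn_integral_real_affine[of "\<lambda>y. f (Complex x y)" x 0]) (auto simp: nn_integral_cmult)
  qed
  also have "\<dots> = (\<integral>\<^sup>+m. \<integral>\<^sup>+x. ennreal \<bar>x\<bar> * f (Complex x (x * m)) \<partial>lborel \<partial>lborel)"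
    by (rule lborel_pair.Fubini') measurable
  also have "\<dots> = (\<integral>\<^sup>+m. ennreal (1 / (1 + m\<^sup>2)) * (\<integral>\<^sup>+s. ennreal \<bar>s\<bar> * f (of_real s * ray m) \<partial>lborel) \<partial>lborel)"
  proof (rule nn_integral_cong)
    fix m :: real
    define k where "k = 1 / sqrt (1 + m\<^sup>2)"
    have pos: "1 + m\<^sup>2 > 0" by (simp add: add_pos_nonneg)
    then have k: "k > 0" "k * k = 1 / (1 + m\<^sup>2)" by (auto simp: k_def field_simps)
    have eq: "Complex (k * s) (k * s * m) = of_real s * ray m" for s
      by (simp add: ray_def k_def complex_eq_iff field_simps)
    have "(\<integral>\<^sup>+x. ennreal \<bar>x\<bar> * f (Complex x (x * m)) \<partial>lborel)
       = ennreal k * (\<integral>\<^sup>+s. ennreal \<bar>k * s\<bar> * f (Complex (k * s) (k * s * m)) \<partial>lborel)"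
      using k by (subst nn_integral_real_affine[of _ k 0]) auto
    also have "\<dots> = ennreal k * (\<integral>\<^sup>+s. ennreal k * (ennreal \<bar>s\<bar> * f (of_real s * ray m)) \<partial>lborel)"
      using k by (simp add: eq[symmetric] abs_mult ennreal_mult mult.assoc)
    also have "\<dots> = ennreal (k * k) * (\<integral>\<^sup>+s. ennreal \<bar>s\<bar> * f (of_real s * ray m) \<partial>lborel)"
      using k(1) by (subst nn_integral_cmult) (auto simp: ennreal_mult mult.assoc)
    finally show "(\<integral>\<^sup>+x. ennreal \<bar>x\<bar> * f (Complex x (x * m)) \<partial>lborel)
       = ennreal (1 / (1 + m\<^sup>2)) * (\<integral>\<^sup>+s. ennreal \<bar>s\<bar> * f (of_real s * ray m) \<partial>lborel)"
      by (simp add: k)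
  qed
  finally show ?thesis .
qed

lemma nn_integral_even:
  fixes f :: "real \<Rightarrow> ennreal"
  assumes [measurable]: "f \<in> borel_measurable borel" 
  shows "(\<integral>\<^sup>+x. f x \<partial>lborel) = (\<integral>\<^sup>+x. (f x + f (- x)) * indicator {0<..} x \<partial>lborel)"
proof -
  have "(\<integral>\<^sup>+x. f x \<partial>lborel) = (\<integral>\<^sup>+x. f x * indicator {0<..} x + f x * indicator {..<0} x \<partial>lborel)"
    by (rule nn_integral_cong_AE, rule AE_mp[OF AE_lborel_singleton[of 0]], intro AE_I2 impI)
       (auto simp: indicator_def)
  also have "\<dots> = (\<integral>\<^sup>+x. f x * indicator {0<..} x \<partial>lborel) + (\<integral>\<^sup>+x. f x * indicator {..<0} x \<partial>lborel)"
    by (rule nn_integral_add) auto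
  also have "(\<integral>\<^sup>+x. f x * indicator {..<0} x \<partial>lborel) = (\<integral>\<^sup>+x. f (- x) * indicator {0<..} x \<partial>lborel)"
    by (subst nn_integral_real_affine[of _ "-1" 0]) (auto simp: indicator_def intro!: nn_integral_cong)
  finally show ?thesis by (simp add: nn_integral_add distrib_right)
qed

text \<open>Lines through the origin sweep only the angle pi; the missing factor 2 of the full
  circle comes from the two signs of \<open>s\<close> on each line.\<close>

lemma nn_integral_arctan: "(\<integral>\<^sup>+m. ennreal (1 / (1 + m\<^sup>2)) \<partial>lborel) = ennreal pi"
proof -
  have "(\<integral>\<^sup>+m. ennreal (1 / (1 + m\<^sup>2)) * indicator {0..} m \<partial>lborel) = ennreal (pi / 2 - arctan 0)"
    by (rule nn_integral_FTC_atLeast)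
       (auto intro!: derivative_eq_intros tendsto_arctan_at_top simp: field_simps)
  moreover have "(\<integral>\<^sup>+m. ennreal (1 / (1 + m\<^sup>2)) \<partial>lborel) = 
     (\<integral>\<^sup>+m. ennreal 2 * (ennreal (1 / (1 + m\<^sup>2)) * indicator {0..} m) \<partial>lborel)"
    by (subst nn_integral_even, measurable, rule nn_integral_cong_AE, rule AE_mp[OF AE_lborel_singleton[of 0]], intro AE_I2 impI)
      (auto simp: indicator_def mult_2[symmetric] simp flip: ennreal_plus ennreal_mult'')
  moreover have "ennreal 2 * ennreal (pi / 2) = ennreal pi"
    by (subst ennreal_mult[symmetric]) auto
  ultimately show ?thesis by (simp add: nn_integral_cmult)
qed

lemma nn_integral_radial:
  fixes f :: "real \<Rightarrow> ennreal"
  assumes [measurable]: "f \<in> borel_measurable borel"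
  shows "(\<integral>\<^sup>+z. f (cmod z) \<partial>lborel) = ennreal (2 * pi) * (\<integral>\<^sup>+s. ennreal s * f s * indicator {0<..} s \<partial>lborel)"
proof -
  let ?X = "\<integral>\<^sup>+s. ennreal s * f s * indicator {0<..} s \<partial>lborel"
  have "(\<integral>\<^sup>+s. ennreal \<bar>s\<bar> * f \<bar>s\<bar> \<partial>lborel) = (\<integral>\<^sup>+s. ennreal 2 * (ennreal s * f s * indicator {0<..} s) \<partial>lborel)"
    by (subst nn_integral_even) (auto intro!: nn_integral_cong simp: indicator_def mult_2[symmetric])
  also have "\<dots> = ennreal 2 * ?X" by (rule nn_integral_cmult) auto
  finally show ?thesis
    by (subst nn_integral_polar, measurable)
       (simp add: norm_mult nn_integral_multc nn_integral_arctan flip: mult.assoc, simp add: mult.commute ennreal_mult)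
qed

section \<open>Arc length\<close>

lemma arc_length_upper:
  assumes "mono_on {..n} t" "t ` {..n} \<subseteq> {a..b}"
  shows "(\<Sum>i<n. ennreal (dist (\<gamma> (t i)) (\<gamma> (t (Suc i))))) \<le> arc_length \<gamma> a b"
  unfolding arc_length_def by (rule SUP_upper2[of "(n, t)"]) (use assms in auto)

lemma arc_length_least:
  assumes "\<And>n t. mono_on {..n} t \<Longrightarrow> t ` {..n} \<subseteq> {a..b} \<Longrightarrow>
    (\<Sum>i<n. ennreal (dist (\<gamma> (t i)) (\<gamma> (t (Suc i))))) \<le> L"
  shows "arc_length \<gamma> a b \<le> L"
  unfolding arc_length_def by (rule SUP_least) (use assms in auto)

lemma arc_length_mono: "a' \<le> a \<Longrightarrow> b \<le> b' \<Longrightarrow> arc_length \<gamma> a b \<le> arc_length \<gamma> a' b'"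
  by (rule arc_length_least, rule arc_length_upper) force+

lemma dist_le_arc_length:
  assumes "a \<le> b"
  shows "ennreal (dist (\<gamma> a) (\<gamma> b)) \<le> arc_length \<gamma> a b"
  using arc_length_upper[of 1 "\<lambda>i. if i = 0 then a else b" a b \<gamma>] assms
  by (auto simp: mono_on_def image_subset_iff)

lemma arc_length_empty: "b < a \<Longrightarrow> arc_length \<gamma> a b = 0"
  by (rule antisym, rule arc_length_least) auto

lemma arc_length_superadd:
  assumes "a \<le> c" "c \<le> b"
  shows "arc_length \<gamma> a c + arc_length \<gamma> c b \<le> arc_length \<gamma> a b"
proof -
  define S where "S a b = {(n :: nat, t :: nat \<Rightarrow> real). mono_on {..n} t \<and> t ` {..n} \<subseteq> {a..b}}" for a b
  define len where "len = (\<lambda>(n :: nat, t :: nat \<Rightarrow> real). \<Sum>i<n. ennreal (dist (\<gamma> (t i)) (\<gamma> (t (Suc i)))))"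
  have arc: "arc_length \<gamma> a b = (SUP p\<in>S a b. len p)" for a b
    by (simp add: arc_length_def S_def len_def)
  have ne: "S a b \<noteq> {}" if "a \<le> b" for a b
    using that by (auto simp: S_def mono_on_def intro!: exI[of _ "0::nat"] exI[of _ "\<lambda>_. a"])
  have "len p + len q \<le> arc_length \<gamma> a b" if "p \<in> S a c" "q \<in> S c b" for p q
  proof -
    obtain n t m s where p: "p = (n, t)" "q = (m, s)" by force
    with that have t: "mono_on {..n} t" "\<And>i. i \<le> n \<Longrightarrow> a \<le> t i \<and> t i \<le> c"
      and s: "mono_on {..m} s" "\<And>i. i \<le> m \<Longrightarrow> c \<le> s i \<and> s i \<le> b"
      by (auto simp: S_def image_subset_iff)
    \<comment> \<open>The points of \<open>t\<close> followed by those of \<open>s\<close>. The join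
      has \<open>Suc n + m\<close> increments: n from \<open>t\<close>, m from \<open>s\<close>, and
      the jump from \<open>t n\<close> to \<open>s 0\<close>, whose nonnegative contribution is
      dropped in the final estimate.\<close>
    define u where "u i = (if i \<le> n then t i else s (i - Suc n))" for i
    have "mono_on {..Suc n + m} u"
    proof (rule mono_onI)
      fix i j assume *: "i \<in> {..Suc n + m}" "j \<in> {..Suc n + m}" "i \<le> j"
      consider "j \<le> n" | "i \<le> n" "n < j" | "n < i" by linarith
      then show "u i \<le> u j"
      proof cases
        case 1 then show ?thesis using * mono_onD[OF t(1), of i j] by (simp add: u_def)
      next
        case 2
        then have "j - Suc n \<le> m" using * by auto
        with 2 show ?thesis using t(2)[of i] s(2)[of "j - Suc n"] by (simp add: u_def)
      next
        case 3 then show ?thesis using * mono_onD[OF s(1), of "i - Suc n" "j - Suc n"] by (simp add: u_def)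
      qed
    qed
    moreover have "u ` {..Suc n + m} \<subseteq> {a..b}"
    proof (rule image_subsetI)
      fix i assume "i \<in> {..Suc n + m}"
      then have "i \<le> n \<or> i - Suc n \<le> m" by auto
      then show "u i \<in> {a..b}"
        using t(2)[of i] s(2)[of "i - Suc n"] \<open>i \<in> _\<close> assms by (auto simp: u_def)
    qed
    ultimately have "(\<Sum>i<Suc n + m. ennreal (dist (\<gamma> (u i)) (\<gamma> (u (Suc i))))) \<le> arc_length \<gamma> a b"
      by (rule arc_length_upper)
    also have "(\<Sum>i<Suc n + m. ennreal (dist (\<gamma> (u i)) (\<gamma> (u (Suc i))))) =
        (\<Sum>i<Suc n. ennreal (dist (\<gamma> (u i)) (\<gamma> (u (Suc i))))) +
        (\<Sum>i<m. ennreal (dist (\<gamma> (u (i + Suc n))) (\<gamma> (u (Suc (i + Suc n))))))"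
      using sum.atLeastLessThan_concat[of 0 "Suc n" "Suc n + m" "\<lambda>i. ennreal (dist (\<gamma> (u i)) (\<gamma> (u (Suc i))))"]
        sum.shift_bounds_nat_ivl[of "\<lambda>i. ennreal (dist (\<gamma> (u i)) (\<gamma> (u (Suc i))))" 0 "Suc n" m]
      by (simp only: lessThan_atLeast0 add_0 add.commute[of m] le_add1 zero_le)
    also have "(\<Sum>i<m. ennreal (dist (\<gamma> (u (i + Suc n))) (\<gamma> (u (Suc (i + Suc n)))))) = len q"
      by (simp add: p len_def u_def)
    also have "len p \<le> (\<Sum>i<Suc n. ennreal (dist (\<gamma> (u i)) (\<gamma> (u (Suc i)))))"
      by (simp add: p len_def u_def)
    finally (xtrans) show ?thesis by (simp add: add_right_mono)
  qed
  then have "(SUP q\<in>S c b. SUP p\<in>S a c. len p + len q) \<le> arc_length \<gamma> a b"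
    by (intro SUP_least) auto
  also have "(SUP q\<in>S c b. SUP p\<in>S a c. len p + len q) = arc_length \<gamma> a c + arc_length \<gamma> c b"
    using ne assms by (simp add: arc[of a c] arc[of c b] ennreal_SUP_add_left ennreal_SUP_add_right)
  finally show ?thesis .
qed

lemma arc_length_subadd:
  assumes "a \<le> c" "c \<le> b"
  shows "arc_length \<gamma> a b \<le> arc_length \<gamma> a c + arc_length \<gamma> c b"
proof (rule arc_length_least)
  fix n and t :: "nat \<Rightarrow> real" assume t: "mono_on {..n} t" "t ` {..n} \<subseteq> {a..b}"
  \<comment> \<open>clamping a partition at \<open>c\<close> from either side replaces inserting \<open>c\<close> into it\<close>
  let ?t1 = "\<lambda>i. min (t i) c" and ?t2 = "\<lambda>i. max (t i) c"
  have "(\<Sum>i<n. ennreal (dist (\<gamma> (t i)) (\<gamma> (t (Suc i)))))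
    \<le> (\<Sum>i<n. ennreal (dist (\<gamma> (?t1 i)) (\<gamma> (?t1 (Suc i)))) + ennreal (dist (\<gamma> (?t2 i)) (\<gamma> (?t2 (Suc i)))))"
  proof (rule sum_mono)
    fix i assume "i \<in> {..<n}"
    then have "t i \<le> t (Suc i)" by (intro mono_onD[OF t(1)]) auto
    then have "dist (\<gamma> (t i)) (\<gamma> (t (Suc i))) \<le> dist (\<gamma> (?t1 i)) (\<gamma> (?t1 (Suc i))) + dist (\<gamma> (?t2 i)) (\<gamma> (?t2 (Suc i)))"
      using dist_triangle[of "\<gamma> (t i)" "\<gamma> (t (Suc i))" "\<gamma> c"]
      by (cases "t i \<le> c"; cases "t (Suc i) \<le> c") (auto simp: min_def max_def)
    then show "ennreal (dist (\<gamma> (t i)) (\<gamma> (t (Suc i)))) \<le>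
      ennreal (dist (\<gamma> (?t1 i)) (\<gamma> (?t1 (Suc i)))) + ennreal (dist (\<gamma> (?t2 i)) (\<gamma> (?t2 (Suc i))))"
      by (simp flip: ennreal_plus)
  qed
  also have "\<dots> \<le> arc_length \<gamma> a c + arc_length \<gamma> c b"
    unfolding sum.distrib
  proof (intro add_mono arc_length_upper)
    show "mono_on {..n} ?t1" "mono_on {..n} ?t2"
      using t(1) by (force simp: mono_on_def intro: min.mono max.mono)+
    show "?t1 ` {..n} \<subseteq> {a..c}" "?t2 ` {..n} \<subseteq> {c..b}" using t(2) assms by (auto simp: image_subset_iff)
  qed
  finally show "(\<Sum>i<n. ennreal (dist (\<gamma> (t i)) (\<gamma> (t (Suc i))))) \<le> arc_length \<gamma> a c + arc_length \<gamma> c b" .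
qed

lemma arc_length_add:
  "a \<le> c \<Longrightarrow> c \<le> b \<Longrightarrow> arc_length \<gamma> a b = arc_length \<gamma> a c + arc_length \<gamma> c b"
  by (intro antisym arc_length_subadd arc_length_superadd)

lemma arc_length_lower_semicontinuous:
  assumes cont: "continuous_on {c..b} \<gamma>" and "c < b" and less: "y < arc_length \<gamma> c b"
  shows "eventually (\<lambda>x. y < arc_length \<gamma> x b) (at_right c)"
proof -
  from less obtain n and t :: "nat \<Rightarrow> real" where t: "mono_on {..n} t" "t ` {..n} \<subseteq> {c..b}"
    and y: "y < (\<Sum>i<n. ennreal (dist (\<gamma> (t i)) (\<gamma> (t (Suc i)))))"
    unfolding arc_length_def less_SUP_iff by auto
  \<comment> \<open>the partition clamped to \<open>{x..b}\<close> has a polygonal length that is continuous in \<open>x\<close>\<close>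
  let ?S = "\<lambda>x. \<Sum>i<n. ennreal (dist (\<gamma> (max (t i) x)) (\<gamma> (max (t (Suc i)) x)))"
  have ev: "eventually (\<lambda>x. c < x \<and> x < b) (at_right c)"
    using eventually_at_right_less[of c] eventually_at_right_field \<open>c < b\<close> by (auto simp: eventually_conj_iff)
  have lim: "((\<lambda>x. \<gamma> (max (t i) x)) \<longlongrightarrow> \<gamma> (t i)) (at_right c)" if "i \<le> n" for i
  proof -
    have ti: "c \<le> t i" "t i \<le> b" using t(2) that by auto
    have "(\<gamma> \<longlongrightarrow> \<gamma> (t i)) (at (t i) within {c..b})"
      using cont ti by (auto simp: continuous_on)
    moreover have "((\<lambda>x. max (t i) x) \<longlongrightarrow> t i) (at_right c)"
      using tendsto_max[OF tendsto_const[of "t i"] tendsto_ident_at[of c "{c<..}"]] ti by (simp add: max_absorb1)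
    moreover have "eventually (\<lambda>x. max (t i) x \<in> {c..b}) (at_right c)"
      using ev by eventually_elim (use ti in auto)
    ultimately show ?thesis
      using cont ti by (intro continuous_on_tendsto_compose[OF cont]) auto
  qed
  have "(?S \<longlongrightarrow> (\<Sum>i<n. ennreal (dist (\<gamma> (t i)) (\<gamma> (t (Suc i)))))) (at_right c)"
    by (intro tendsto_sum tendsto_ennrealI tendsto_dist lim) auto
  from order_tendstoD(1)[OF this y] ev show ?thesis
  proof eventually_elim
    case (elim x)
    have "?S x \<le> arc_length \<gamma> x b"
    proof (rule arc_length_upper)
      show "mono_on {..n} (\<lambda>i. max (t i) x)" using t(1) by (force simp: mono_on_def intro: max.mono)
      show "(\<lambda>i. max (t i) x) ` {..n} \<subseteq> {x..b}" using t(2) elim by (auto simp: image_subset_iff)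
    qed
    with elim show ?case by auto
  qed
qed

text \<open>Lower bounds near c follow from monotonicity. For upper bounds, the lengths over
  \<open>{a..x}\<close> and \<open>{x..b}\<close> have a finite sum independent of x, so lower
  semicontinuity of the second is upper semicontinuity of the first.\<close>

lemma arc_length_right_continuous:
  assumes cont: "continuous_on {a..b} \<gamma>" and fin: "arc_length \<gamma> a b < \<infinity>" and c: "a \<le> c" "c < b"
  shows "((\<lambda>x. arc_length \<gamma> a x) \<longlongrightarrow> arc_length \<gamma> a c) (at_right c)"
proof (rule order_tendstoI)
  have ev: "eventually (\<lambda>x. c < x \<and> x < b) (at_right c)"
    using eventually_at_right_less[of c] eventually_at_right_field \<open>c < b\<close> by (auto simp: eventually_conj_iff)
  fix y
  { assume "y < arc_length \<gamma> a c"
    then show "eventually (\<lambda>x. y < arc_length \<gamma> a x) (at_right c)"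
      by (intro eventually_mono[OF ev]) (auto intro: less_le_trans[OF _ arc_length_mono]) }
  { assume y: "arc_length \<gamma> a c < y"
    have cb: "continuous_on {c..b} \<gamma>" using cont c by (auto intro: continuous_on_subset)
    have split: "arc_length \<gamma> a b = arc_length \<gamma> a x + arc_length \<gamma> x b" if "a \<le> x" "x \<le> b" for x
      using that by (rule arc_length_add)
    have fin': "arc_length \<gamma> a x < \<infinity>" "arc_length \<gamma> x b < \<infinity>" if "a \<le> x" "x \<le> b" for x
      using split[OF that] fin by auto
    show "eventually (\<lambda>x. arc_length \<gamma> a x < y) (at_right c)"
    \<comment> \<open>The other case uses \<open>ennreal (v - e) < ennreal v\<close>. Since
      \<open>ennreal\<close> truncates \<open>v - e\<close> at 0, this needs v to be
      positive.\<close>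
    proof (cases "arc_length \<gamma> c b = 0")
      case True
      have "arc_length \<gamma> a x < y" if "c < x \<and> x < b" for x
        using arc_length_mono[of a a x b \<gamma>] split[of c] True y c that by auto
      then show ?thesis using ev by (auto elim!: eventually_mono)
    next
      case False
      obtain e where e: "0 < e" "arc_length \<gamma> a c + ennreal e \<le> y"
      proof (cases y)
        case (real z)
        obtain w where w: "arc_length \<gamma> a c = ennreal w" "w \<ge> 0" using fin'[of c] c by (cases "arc_length \<gamma> a c") auto
        show ?thesis using real w y by (intro that[of "z - w"]) (auto simp flip: ennreal_plus simp: ennreal_less_iff)
      next
        case top then show ?thesis by (intro that[of 1]) auto
      qed
      obtain v where v: "arc_length \<gamma> c b = ennreal v" "v > 0"
        using fin'[of c] c False by (cases "arc_length \<gamma> c b") (auto simp: less_le)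
      have "ennreal (v - e) < arc_length \<gamma> c b" unfolding v using v e by (simp add: ennreal_lessI)
      from arc_length_lower_semicontinuous[OF cb c(2) this] ev show ?thesis
      proof eventually_elim
        case (elim x)
        obtain w where w: "arc_length \<gamma> x b = ennreal w" "w \<ge> 0" using fin'[of x] c elim by (cases "arc_length \<gamma> x b") auto
        obtain z where z: "arc_length \<gamma> a x = ennreal z" "z \<ge> 0" using fin'[of x] c elim by (cases "arc_length \<gamma> a x") auto
        obtain q where q: "arc_length \<gamma> a c = ennreal q" "q \<ge> 0" using fin'[of c] c by (cases "arc_length \<gamma> a c") auto
        have "ennreal (z + w) = ennreal (q + v)" using split[of x] split[of c] c elim w z q v by (simp)
        then have "z + w = q + v" using w z q v by (subst (asm) ennreal_inj) auto
        moreover have "v - e < w" using elim w by (cases "0 \<le> v - e") (auto simp: ennreal_less_iff)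
        ultimately have "z < q + e" by simp
        then have "arc_length \<gamma> a x < ennreal (q + e)" using z by (simp add: ennreal_less_iff)
        also have "\<dots> \<le> y" using e q by simp
        finally show ?case .
      qed
    qed }
qed

section \<open>The Stieltjes measure of arc length\<close>

definition arc_length_measure :: "(real \<Rightarrow> complex) \<Rightarrow> real \<Rightarrow> real \<Rightarrow> real measure" where
  "arc_length_measure \<gamma> a b = interval_measure (\<lambda>t. enn2real (arc_length \<gamma> a (min b t)))"

lemma sets_arc_length_measure [simp, measurable_cong]: "sets (arc_length_measure \<gamma> a b) = sets borel"
  by (simp add: arc_length_measure_def)

lemma space_arc_length_measure [simp]: "space (arc_length_measure \<gamma> a b) = UNIV"
  by (simp add: arc_length_measure_def)

lemma emeasure_arc_length_measure_Ioc:
  assumes cont: "continuous_on {a..b} \<gamma>" and fin: "arc_length \<gamma> a b < \<infinity>" and "a \<le> b" "c \<le> d"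
  shows "emeasure (arc_length_measure \<gamma> a b) {c<..d} =
    ennreal (enn2real (arc_length \<gamma> a (min b d)) - enn2real (arc_length \<gamma> a (min b c)))"
  unfolding arc_length_measure_def
proof (rule emeasure_interval_measure_Ioc[OF \<open>c \<le> d\<close>])
  let ?F = "\<lambda>t. enn2real (arc_length \<gamma> a (min b t))"
  have fin': "arc_length \<gamma> a (min b t) < \<infinity>" for t
    using arc_length_mono[of a a "min b t" b \<gamma>] fin by (auto intro: le_less_trans)
  show "?F x \<le> ?F y" if "x \<le> y" for x y
    using that fin'[of y] by (intro enn2real_mono arc_length_mono) auto
  fix x
  consider "x < a" | "a \<le> x" "x < b" | "b \<le> x" by linarith
  then show "continuous (at_right x) ?F"
  proof cases
    case 1
    have "eventually (\<lambda>t. ?F t = ?F x) (at_right x)"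
      using eventually_at_right_real[OF 1] 1 \<open>a \<le> b\<close>
      by (auto elim!: eventually_mono simp: arc_length_empty min_def)
    then show ?thesis unfolding continuous_within by (rule tendsto_eventually)
  next
    case 2
    have "((\<lambda>t. arc_length \<gamma> a t) \<longlongrightarrow> arc_length \<gamma> a x) (at_right x)"
      using arc_length_right_continuous[OF cont fin] 2 by auto
    then have "((\<lambda>t. enn2real (arc_length \<gamma> a t)) \<longlongrightarrow> enn2real (arc_length \<gamma> a x)) (at_right x)"
      using fin'[of x] 2 by (intro tendsto_enn2real) (auto simp: min_absorb2)
    moreover have "eventually (\<lambda>t. enn2real (arc_length \<gamma> a t) = ?F t) (at_right x)"
      using eventually_at_right_real[OF 2(2)] by (auto elim!: eventually_mono simp: min_absorb2)
    ultimately show ?thesis using 2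
      by (simp add: continuous_within min_absorb2 Lim_transform_eventually)
  next
    case 3
    have "eventually (\<lambda>t. ?F t = ?F x) (at_right x)"
      using eventually_at_right_less[of x] 3 by (auto elim!: eventually_mono simp: min_absorb1)
    then show ?thesis unfolding continuous_within by (rule tendsto_eventually)
  qed
qed

text \<open>The measure dominates chords; this is the one quantitative property of it that the lower
  bound for line integrals along general curves uses.\<close>

lemma dist_le_emeasure_arc_length:
  assumes cont: "continuous_on {a..b} \<gamma>" and fin: "arc_length \<gamma> a b < \<infinity>" and cd: "a \<le> c" "c \<le> d" "d \<le> b"
  shows "ennreal (dist (\<gamma> c) (\<gamma> d)) \<le> emeasure (arc_length_measure \<gamma> a b) {c<..d}"
proof -
  have "arc_length \<gamma> a d < \<infinity>" 
    using arc_length_mono[of a a d b \<gamma>] fin cd by (auto intro: le_less_trans)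
  then obtain x y z where "arc_length \<gamma> a c = ennreal x" "arc_length \<gamma> c d = ennreal y" "x \<ge> 0" "y \<ge> 0"
    using arc_length_add[of a c d \<gamma>] cd by (cases "arc_length \<gamma> a c"; cases "arc_length \<gamma> c d") auto
  then show ?thesis
    using dist_le_arc_length[of c d \<gamma>] arc_length_add[of a c d \<gamma>] cd
    by (subst emeasure_arc_length_measure_Ioc[OF cont fin]) (auto simp: min_absorb2 simp flip: ennreal_plus)
qed

lemma arc_length_segment:
  assumes "a \<le> b"
  shows "arc_length (\<lambda>t. z + of_real t * w) a b = ennreal (cmod w * (b - a))"
proof (rule antisym)
  have dist: "dist (z + of_real s * w) (z + of_real t * w) = cmod w * (t - s)" if "s \<le> t" for s t
  proof -
    have "dist (z + of_real s * w) (z + of_real t * w) = cmod (of_real (s - t) * w)"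
      by (simp add: dist_norm algebra_simps)
    also have "\<dots> = cmod w * (t - s)" using that by (simp only: norm_mult norm_of_real) simp
    finally show ?thesis .
  qed
  show "ennreal (cmod w * (b - a)) \<le> arc_length (\<lambda>t. z + of_real t * w) a b"
    using dist_le_arc_length[OF assms, of "\<lambda>t. z + of_real t * w"] dist[OF assms] by simp
  show "arc_length (\<lambda>t. z + of_real t * w) a b \<le> ennreal (cmod w * (b - a))"
  proof (rule arc_length_least)
    fix n and t :: "nat \<Rightarrow> real" assume t: "mono_on {..n} t" "t ` {..n} \<subseteq> {a..b}"
    have "(\<Sum>i<n. ennreal (dist (z + of_real (t i) * w) (z + of_real (t (Suc i)) * w)))
       = (\<Sum>i<n. ennreal (cmod w * (t (Suc i) - t i)))"
      using mono_onD[OF t(1)] by (intro sum.cong refl arg_cong[of _ _ ennreal] dist) auto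
    also have "\<dots> = ennreal (\<Sum>i<n. cmod w * (t (Suc i) - t i))"
      using mono_onD[OF t(1)] by (intro sum_ennreal) auto
    also have "(\<Sum>i<n. cmod w * (t (Suc i) - t i)) = cmod w * (t n - t 0)"
      by (simp add: sum_lessThan_telescope flip: sum_distrib_left)
    also have "ennreal (cmod w * (t n - t 0)) \<le> ennreal (cmod w * (b - a))"
    proof -
      have "t n \<le> b" "a \<le> t 0" using t(2) by auto
      then show ?thesis by (intro ennreal_leI mult_left_mono) auto
    qed
    finally show "(\<Sum>i<n. ennreal (dist (z + of_real (t i) * w) (z + of_real (t (Suc i)) * w))) \<le> ennreal (cmod w * (b - a))" .
  qed
qed

lemma locally_rectifiable_segment: "locally_rectifiable (\<lambda>t. z + of_real t * w)"
  by (auto simp: locally_rectifiable_def arc_length_segment)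

text \<open>The arc length of a segment is linear in the parameter, so the two measures agree on
  half-open intervals, an intersection-stable generator. This turns line integrals along rays into
  Lebesgue integrals.\<close>

lemma arc_length_measure_segment:
  assumes "a \<le> b"
  shows "arc_length_measure (\<lambda>t. z + of_real t * w) a b = density lborel (\<lambda>t. ennreal (cmod w) * indicator {a..b} t)"
    (is "?M = ?D")
proof -
  let ?E = "range (\<lambda>(c, d). {c<..d :: real})"
  have cont: "continuous_on {a..b} (\<lambda>t. z + of_real t * w)" by (intro continuous_intros)
  have eq: "emeasure ?M {c<..d} = ennreal (cmod w * (max a (min b d) - max a (min b c)))" if "c \<le> d" for c d
  proof -
    have "enn2real (arc_length (\<lambda>t. z + of_real t * w) a (min b t)) = cmod w * (max a (min b t) - a)" for t
      using assms by (cases "a \<le> min b t") (auto simp: arc_length_segment arc_length_empty max_def)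
    then show ?thesis
      using assms by (subst emeasure_arc_length_measure_Ioc[OF cont _ assms that]) (auto simp: arc_length_segment right_diff_distrib)
  qed
  have eqD: "emeasure ?D {c<..d} = ennreal (cmod w * (max a (min b d) - max a (min b c)))" if "c \<le> d" for c d
  proof -
    have "emeasure ?D {c<..d} = (\<integral>\<^sup>+t. ennreal (cmod w) * indicator ({a..b} \<inter> {c<..d}) t \<partial>lborel)"
      by (subst emeasure_density) (auto simp: indicator_def intro!: nn_integral_cong)
    \<comment> \<open>The two sets differ at most in the point \<open>a\<close>, which the closed
      interval may contain and the half-open one does not.\<close>
    also have "\<dots> = (\<integral>\<^sup>+t. ennreal (cmod w) * indicator {max a (min b c)<..max a (min b d)} t \<partial>lborel)"
      by (rule nn_integral_cong_AE, rule AE_mp[OF AE_lborel_singleton[of a]], intro AE_I2 impI)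
         (use assms that in \<open>auto simp: indicator_def max_def min_def split: if_splits\<close>)
    also have "\<dots> = ennreal (cmod w * (max a (min b d) - max a (min b c)))"
      using assms that by (auto simp: nn_integral_cmult ennreal_mult)
    finally show ?thesis .
  qed
  show ?thesis
  proof (rule measure_eqI_generator_eq[of ?E UNIV _ _ "\<lambda>n. {- real n<..real n}"])
    show "Int_stable ?E"
    proof (unfold Int_stable_def, intro ballI)
      fix X Y :: "real set" assume "X \<in> ?E" "Y \<in> ?E"
      then obtain c d c' d' where "X = {c<..d}" "Y = {c'<..d'}" by auto
      then have "X \<inter> Y = {max c c'<..min d d'}" by auto
      then show "X \<inter> Y \<in> ?E" by auto
    qed
    show "emeasure ?M X = emeasure ?D X" if "X \<in> ?E" for X
    proof -
      obtain c d where X: "X = {c<..d}" using \<open>X \<in> ?E\<close> by auto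
      show ?thesis by (cases "c \<le> d") (auto simp: X eq eqD)
    qed
    show "(\<Union>n. {- real n<..real n}) = (UNIV :: real set)"
    proof -
      have "\<exists>n. - real n < x \<and> x \<le> real n" for x
        by (metis abs_less_iff linear minus_less_iff not_less reals_Archimedean2 less_imp_le)
      then show ?thesis by auto
    qed
  qed (auto simp: borel_sigma_sets_Ioc eq)
qed

section \<open>Modulus of radial weights\<close>

text \<open>Near each parameter value \<open>f\<close> is almost constant along the curve, so the
  increment of \<open>g\<close> is at most \<open>hi\<close> times a chord, and the chord is at most
  the arc length measure. Comparing \<open>hi\<close> with the lower bound \<open>lo\<close> for
  \<open>f\<close> costs a factor q < 1. Compactness adds up the local estimates with the same q,
  and q tends to 1 at the end.\<close>

lemma line_integral_on_radial_ge:
  fixes f F :: "real \<Rightarrow> real"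
  assumes f_meas [measurable]: "f \<in> borel_measurable borel"
    and deriv: "\<And>s. r < s \<Longrightarrow> s < R \<Longrightarrow> (F has_real_derivative f s) (at s)"
    and f_cont: "\<And>s. r < s \<Longrightarrow> s < R \<Longrightarrow> isCont f s"
    and f_pos: "\<And>s. r < s \<Longrightarrow> s < R \<Longrightarrow> 0 < f s"
    and "a \<le> b" and cont: "continuous_on {a..b} \<gamma>" and fin: "arc_length \<gamma> a b < \<infinity>"
    and in_A: "\<gamma> ` {a..b} \<subseteq> annulus r R"
  shows "ennreal \<bar>F (cmod (\<gamma> b)) - F (cmod (\<gamma> a))\<bar> \<le>
    line_integral_on (\<lambda>z. ennreal (f (cmod z)) * indicator (annulus r R) z) \<gamma> a b"
proof -
  let ?\<mu> = "arc_length_measure \<gamma> a b"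
  define g where "g t = F (cmod (\<gamma> t))" for t
  define w where "w t = ennreal (f (cmod (\<gamma> t))) * indicator {a..b} t" for t
  have in_A': "r < cmod (\<gamma> t)" "cmod (\<gamma> t) < R" if "a \<le> t" "t \<le> b" for t
    using in_A that by (auto simp: annulus_def image_subset_iff)
  \<comment> \<open>\<gamma> is continuous only on \<open>{a..b}\<close>; cutting it off there gives
    a Borel function on the whole line.\<close>
  have [measurable]: "(\<lambda>t. indicator {a..b} t *\<^sub>R \<gamma> t) \<in> borel_measurable borel"
    using cont by (intro borel_measurable_continuous_on_indicator) auto
  have w_eq: "w = (\<lambda>t. ennreal (f (cmod (indicator {a..b} t *\<^sub>R \<gamma> t))) * indicator {a..b} t)"
    by (auto simp: w_def indicator_def)
  have w_meas [measurable]: "w \<in> borel_measurable borel" unfolding w_eq by measurable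
  define \<nu> where "\<nu> = density ?\<mu> w"
  have [simp]: "sets \<nu> = sets borel" by (simp add: \<nu>_def)
  have main: "ennreal (q * \<bar>g b - g a\<bar>) \<le> emeasure \<nu> {a<..b}" if q: "0 < q" "q < 1" for q
  proof -
    \<comment> \<open>The claim is additive over adjacent intervals and holds for short intervals
      around each point, which is what \<open>Bolzano\<close> asks for. Its local hypothesis ranges
      over all short intervals around x, also those that leave \<open>{a..b}\<close>; the guard
      excludes these.\<close>
    have "a \<le> a \<and> b \<le> b \<longrightarrow> ennreal (q * \<bar>g b - g a\<bar>) \<le> emeasure \<nu> {a<..b}"
    proof (induction rule: Bolzano[where P = "\<lambda>c d. a \<le> c \<and> d \<le> b \<longrightarrow> ennreal (q * \<bar>g d - g c\<bar>) \<le> emeasure \<nu> {c<..d}", OF \<open>a \<le> b\<close>])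
      case (1 c d e)
      show ?case
      proof
        assume *: "a \<le> c \<and> e \<le> b"
        have "q * \<bar>g e - g c\<bar> \<le> q * \<bar>g d - g c\<bar> + q * \<bar>g e - g d\<bar>"
          using q by (simp flip: distrib_left)
        then have "ennreal (q * \<bar>g e - g c\<bar>) \<le> ennreal (q * \<bar>g d - g c\<bar>) + ennreal (q * \<bar>g e - g d\<bar>)"
          using q by (simp add: ennreal_leI flip: ennreal_plus)
        also have "\<dots> \<le> emeasure \<nu> {c<..d} + emeasure \<nu> {d<..e}"
          using 1 * by (intro add_mono) auto
        also have "\<dots> = emeasure \<nu> ({c<..d} \<union> {d<..e})"
          by (rule plus_emeasure) auto
        also have "{c<..d} \<union> {d<..e} = {c<..e}" using 1 by auto
        finally show "ennreal (q * \<bar>g e - g c\<bar>) \<le> emeasure \<nu> {c<..e}" .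
      qed
    next
      case (2 x)
      define f0 where "f0 = f (cmod (\<gamma> x))"
      \<comment> \<open>bounds of \<open>f\<close> near \<open>x\<close>, chosen so that the loss factor is exactly \<open>q = lo / hi\<close>\<close>
      define lo hi where "lo = f0 * ((1 + q) / 2)" and "hi = f0 * ((1 + q) / (2 * q))"
      have x: "r < cmod (\<gamma> x)" "cmod (\<gamma> x) < R" using in_A' 2 by auto
      have f0: "f0 > 0" unfolding f0_def using f_pos x by auto
      have lohi: "0 < lo" "lo < f0" "f0 < hi" "q * hi = lo"
        using f0 q by (auto simp: lo_def hi_def field_simps add_pos_pos)
      have "(f \<longlongrightarrow> f0) (nhds (cmod (\<gamma> x)))"
        using f_cont[OF x] by (simp add: isCont_def f0_def tendsto_nhds_iff)
      then have "\<forall>\<^sub>F y in nhds (cmod (\<gamma> x)). lo < f y \<and> f y < hi \<and> r < y \<and> y < R"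
        using order_tendstoD[of f f0] lohi x eventually_nhds_in_open[of "{r<..<R}" "cmod (\<gamma> x)"]
        by (intro eventually_conj) (auto elim: eventually_mono)
      then obtain e where e: "e > 0" and ball: "\<And>y. dist y (cmod (\<gamma> x)) < e \<Longrightarrow> lo < f y \<and> f y < hi \<and> r < y \<and> y < R"
        unfolding eventually_nhds_metric by blast
      obtain \<delta> where \<delta>: "\<delta> > 0" and close: "\<And>t. t \<in> {a..b} \<Longrightarrow> dist t x < \<delta> \<Longrightarrow> dist (\<gamma> t) (\<gamma> x) < e"
        using cont 2 e unfolding continuous_on_iff by (metis atLeastAtMost_iff)
      show ?case
      proof (intro exI[of _ \<delta>] conjI allI impI \<delta>)
        fix c d assume cd: "c \<le> x \<and> x \<le> d \<and> d - c < \<delta>" "a \<le> c \<and> d \<le> b"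
        have near: "dist (cmod (\<gamma> t)) (cmod (\<gamma> x)) < e" if "c \<le> t" "t \<le> d" for t
        proof -
          have "dist (\<gamma> t) (\<gamma> x) < e" using that cd by (intro close) (auto simp: dist_real_def)
          then show ?thesis
            using norm_triangle_ineq3[of "\<gamma> t" "\<gamma> x"] by (simp add: dist_norm)
        qed
        have "\<bar>g d - g c\<bar> \<le> hi * \<bar>cmod (\<gamma> d) - cmod (\<gamma> c)\<bar>"
        proof -
          have "norm (F (cmod (\<gamma> d)) - F (cmod (\<gamma> c))) \<le> hi * norm (cmod (\<gamma> d) - cmod (\<gamma> c))"
          proof (rule field_differentiable_bound[of "ball (cmod (\<gamma> x)) e" F f])
            fix y assume "y \<in> ball (cmod (\<gamma> x)) e"
            then have y: "lo < f y \<and> f y < hi \<and> r < y \<and> y < R" using ball[of y] by (simp add: dist_commute)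
            then show "(F has_field_derivative f y) (at y within ball (cmod (\<gamma> x)) e)"
              using deriv[of y] by (auto intro: has_field_derivative_at_within)
            show "norm (f y) \<le> hi" using y lohi by auto
          qed (use near[of c] near[of d] cd in \<open>auto simp: dist_commute\<close>)
          then show ?thesis by (simp add: g_def)
        qed
        also have "\<dots> \<le> hi * dist (\<gamma> c) (\<gamma> d)"
          using lohi norm_triangle_ineq3[of "\<gamma> d" "\<gamma> c"] by (intro mult_left_mono) (auto simp: dist_norm norm_minus_commute)
        finally have "q * \<bar>g d - g c\<bar> \<le> q * (hi * dist (\<gamma> c) (\<gamma> d))" using q by (intro mult_left_mono) auto
        also have "\<dots> = lo * dist (\<gamma> c) (\<gamma> d)" using lohi(4) by (simp add: mult.assoc[symmetric])
        finally have "ennreal (q * \<bar>g d - g c\<bar>) \<le> ennreal lo * ennreal (dist (\<gamma> c) (\<gamma> d))"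
          using lohi(1) by (simp add: ennreal_leI flip: ennreal_mult)
        also have "\<dots> \<le> ennreal lo * emeasure ?\<mu> {c<..d}"
          using cd by (intro mult_left_mono dist_le_emeasure_arc_length[OF cont fin]) auto
        also have "\<dots> = (\<integral>\<^sup>+t. ennreal lo * indicator {c<..d} t \<partial>?\<mu>)"
          by (subst nn_integral_cmult_indicator) auto
        also have "\<dots> \<le> (\<integral>\<^sup>+t. w t * indicator {c<..d} t \<partial>?\<mu>)"
        proof (intro nn_integral_mono)
          fix t show "ennreal lo * indicator {c<..d} t \<le> w t * indicator {c<..d} t"
            using ball[of "cmod (\<gamma> t)"] near[of t] cd by (auto simp: indicator_def w_def intro!: ennreal_leI)
        qed
        also have "\<dots> = emeasure \<nu> {c<..d}"
          unfolding \<nu>_def by (subst emeasure_density) auto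
        finally show "ennreal (q * \<bar>g d - g c\<bar>) \<le> emeasure \<nu> {c<..d}" .
      qed
    qed
    then show ?thesis by auto
  qed
  have nu: "emeasure \<nu> {a<..b} \<le> line_integral_on (\<lambda>z. ennreal (f (cmod z)) * indicator (annulus r R) z) \<gamma> a b"
  proof -
    have "emeasure \<nu> {a<..b} = (\<integral>\<^sup>+t. w t * indicator {a<..b} t \<partial>?\<mu>)"
      unfolding \<nu>_def by (subst emeasure_density) auto
    also have "\<dots> \<le> line_integral_on (\<lambda>z. ennreal (f (cmod z)) * indicator (annulus r R) z) \<gamma> a b"
      unfolding line_integral_on_def arc_length_measure_def
      by (intro nn_integral_mono) (use in_A in \<open>auto simp: w_def indicator_def image_subset_iff\<close>)
    finally show ?thesis .
  qed
  show ?thesis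
  proof (cases "line_integral_on (\<lambda>z. ennreal (f (cmod z)) * indicator (annulus r R) z) \<gamma> a b")
    case (real x)
    have "\<bar>g b - g a\<bar> \<le> x"
    proof (rule field_le_mult_one_interval)
      fix q :: real assume "0 < q" "q < 1"
      from order_trans[OF main[OF this] nu] show "q * \<bar>g b - g a\<bar> \<le> x"
        using real by (simp add: ennreal_le_iff)
    qed
    then show ?thesis using real by (simp add: g_def ennreal_leI)
  qed auto
qed

text \<open>Line integrals are suprema over compact parameter intervals, on which the previous bound
  applies. \<open>F (cmod (\<gamma> t))\<close> converges at both ends because \<open>F\<close> is
  continuous at r and R, so the bound passes to the limit, one end at a time; whichever way the
  curve is traversed, the total increment is \<open>F R - F r\<close> in absolute value.\<close>

lemma admissible_radial:
  fixes f F :: "real \<Rightarrow> real"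
  assumes f_meas [measurable]: "f \<in> borel_measurable borel"
    and deriv: "\<And>s. r < s \<Longrightarrow> s < R \<Longrightarrow> (F has_real_derivative f s) (at s)"
    and f_cont: "\<And>s. r < s \<Longrightarrow> s < R \<Longrightarrow> isCont f s"
    and f_pos: "\<And>s. r < s \<Longrightarrow> s < R \<Longrightarrow> 0 < f s"
    and F_cont: "isCont F r" "isCont F R" and "1 \<le> F R - F r"
  shows "admissible (joining_curves r R) (\<lambda>z. ennreal (f (cmod z)) * indicator (annulus r R) z)"
    (is "admissible _ ?\<rho>")
proof -
  have [measurable]: "annulus r R \<in> sets borel"
    unfolding annulus_def by measurable
  have "1 \<le> line_integral ?\<rho> \<gamma>" if \<gamma>: "\<gamma> \<in> joining_curves r R" "locally_rectifiable \<gamma>" for \<gamma>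
  proof (cases "line_integral ?\<rho> \<gamma>")
    case (real x)
    define g where "g t = F (cmod (\<gamma> t))" for t
    from \<gamma> obtain u v where cont: "continuous_on {0<..<1} \<gamma>" and in_A: "\<gamma> ` {0<..<1} \<subseteq> annulus r R"
      and uv: "(\<gamma> \<longlongrightarrow> u) (at_right 0)" "(\<gamma> \<longlongrightarrow> v) (at_left 1)" "cmod u = r \<and> cmod v = R \<or> cmod u = R \<and> cmod v = r"
      by (auto simp: joining_curves_def)
    have g: "(g \<longlongrightarrow> F (cmod u)) (at_right 0)" "(g \<longlongrightarrow> F (cmod v)) (at_left 1)"
      unfolding g_def using F_cont uv by (auto intro!: isCont_tendsto_compose[of _ F] tendsto_norm)
    have le: "\<bar>g b - g a\<bar> \<le> x" if "0 < a" "a \<le> b" "b < 1" for a b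
    proof -
      have ab: "{a..b} \<subseteq> {0<..<1}" using that by auto
      have "ennreal \<bar>g b - g a\<bar> \<le> line_integral_on ?\<rho> \<gamma> a b"
        unfolding g_def
      proof (rule line_integral_on_radial_ge[OF f_meas deriv f_cont f_pos that(2)])
        show "continuous_on {a..b} \<gamma>" using cont ab by (rule continuous_on_subset)
        show "arc_length \<gamma> a b < \<infinity>" using \<gamma>(2) that by (auto simp: locally_rectifiable_def)
        show "\<gamma> ` {a..b} \<subseteq> annulus r R" using in_A ab by blast
      qed
      also have "\<dots> \<le> line_integral ?\<rho> \<gamma>"
        unfolding line_integral_def by (rule SUP_upper2[of "(a, b)"]) (use that in auto)
      finally show ?thesis using real by (simp add: ennreal_le_iff)
    qed
    have le': "\<bar>F (cmod v) - g a\<bar> \<le> x" if "0 < a" "a < 1" for a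
    proof (rule tendsto_upperbound[of "\<lambda>b. \<bar>g b - g a\<bar>" _ "at_left 1"])
      show "((\<lambda>b. \<bar>g b - g a\<bar>) \<longlongrightarrow> \<bar>F (cmod v) - g a\<bar>) (at_left 1)" by (intro tendsto_intros g)
      show "\<forall>\<^sub>F b in at_left 1. \<bar>g b - g a\<bar> \<le> x"
        using eventually_at_left_real[OF that(2)] by eventually_elim (use le that in auto)
    qed auto
    have "\<bar>F (cmod v) - F (cmod u)\<bar> \<le> x"
    proof (rule tendsto_upperbound[of "\<lambda>a. \<bar>F (cmod v) - g a\<bar>" _ "at_right 0"])
      show "((\<lambda>a. \<bar>F (cmod v) - g a\<bar>) \<longlongrightarrow> \<bar>F (cmod v) - F (cmod u)\<bar>) (at_right 0)" by (intro tendsto_intros g)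
      show "\<forall>\<^sub>F a in at_right 0. \<bar>F (cmod v) - g a\<bar> \<le> x"
        using eventually_at_right_real[of 0 1] by (rule eventually_mono) (use le' in auto)
    qed auto
    then have "1 \<le> x" using uv(3) \<open>1 \<le> F R - F r\<close> by auto
    then show ?thesis using real by simp
  qed auto
  then show ?thesis by (auto simp: admissible_def)
qed

section \<open>Admissible densities along radial segments\<close>

lemma borel_annulus [measurable]: "annulus r R \<in> sets borel"
  unfolding annulus_def by measurable

lemma line_integral_segment:
  fixes \<rho> :: "complex \<Rightarrow> ennreal"
  assumes [measurable]: "\<rho> \<in> borel_measurable borel" and "r < R" "cmod w = 1"
  shows "line_integral \<rho> (\<lambda>t. of_real r * w + of_real t * (of_real (R - r) * w))
     \<le> (\<integral>\<^sup>+s. \<rho> (of_real s * w) * indicator {r<..<R} s \<partial>lborel)"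
  unfolding line_integral_def
proof (rule SUP_least, safe)
  let ?\<gamma> = "\<lambda>t. of_real r * w + of_real t * (of_real (R - r) * w)"
  fix a b :: real assume ab: "0 < a" "a \<le> b" "b < 1"
  have \<gamma>: "?\<gamma> t = of_real (r + (R - r) * t) * w" for t
    by (simp add: algebra_simps)
  have cm: "cmod (of_real (R - r) * w) = R - r" using assms by (simp only: norm_mult norm_of_real) simp
  have "line_integral_on \<rho> ?\<gamma> a b = (\<integral>\<^sup>+t. \<rho> (?\<gamma> t) * indicator {a..b} t \<partial>arc_length_measure ?\<gamma> a b)"
    by (simp add: line_integral_on_def arc_length_measure_def)
  also have "\<dots> = (\<integral>\<^sup>+t. ennreal (R - r) * indicator {a..b} t * (\<rho> (?\<gamma> t) * indicator {a..b} t) \<partial>lborel)"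
    unfolding arc_length_measure_segment[OF ab(2)] cm by (rule nn_integral_density) measurable
  also have "\<dots> \<le> (\<integral>\<^sup>+t. ennreal (R - r) * (\<rho> (of_real (r + (R - r) * t) * w) * indicator {r<..<R} (r + (R - r) * t)) \<partial>lborel)"
  proof (intro nn_integral_mono)
    fix t
    have "r < r + (R - r) * t \<and> r + (R - r) * t < R" if "t \<in> {a..b}"
    proof -
      have "0 < (R - r) * t" "0 < (R - r) * (1 - t)" using that ab assms by (auto intro!: mult_pos_pos)
      then show ?thesis by (simp add: algebra_simps)
    qed
    then show "ennreal (R - r) * indicator {a..b} t * (\<rho> (?\<gamma> t) * indicator {a..b} t) \<le>
       ennreal (R - r) * (\<rho> (of_real (r + (R - r) * t) * w) * indicator {r<..<R} (r + (R - r) * t))"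
      unfolding \<gamma> by (auto simp: indicator_def)
  qed
  also have "\<dots> = ennreal (R - r) * (\<integral>\<^sup>+t. \<rho> (of_real (r + (R - r) * t) * w) * indicator {r<..<R} (r + (R - r) * t) \<partial>lborel)"
    by (rule nn_integral_cmult) measurable
  also have "\<dots> = (\<integral>\<^sup>+s. \<rho> (of_real s * w) * indicator {r<..<R} s \<partial>lborel)"
    using \<open>r < R\<close> by (subst nn_integral_real_affine[of "\<lambda>s. \<rho> (of_real s * w) * indicator {r<..<R} s" "R - r" r]) auto
  finally show "line_integral_on \<rho> ?\<gamma> a b \<le> (\<integral>\<^sup>+s. \<rho> (of_real s * w) * indicator {r<..<R} s \<partial>lborel)" .
qed

lemma admissible_on_ray:
  assumes adm: "admissible (joining_curves r R) \<rho>" and "0 < r" "r < R" "cmod w = 1"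
  shows "1 \<le> (\<integral>\<^sup>+s. \<rho> (of_real s * w) * indicator {r<..<R} s \<partial>lborel)"
proof -
  let ?\<gamma> = "\<lambda>t. of_real r * w + of_real t * (of_real (R - r) * w)"
  have \<gamma>: "?\<gamma> t = of_real (r + (R - r) * t) * w" for t
    by (simp add: algebra_simps)
  have cm: "cmod (?\<gamma> t) = \<bar>r + (R - r) * t\<bar>" for t unfolding \<gamma> using assms by (simp only: norm_mult norm_of_real) simp
  have "?\<gamma> \<in> joining_curves r R"
    unfolding joining_curves_def
  proof (safe intro!: continuous_intros)
    fix t :: real assume t: "t \<in> {0<..<1}"
    then have "0 < (R - r) * t" "0 < (R - r) * (1 - t)" using assms by (auto intro!: mult_pos_pos)
    then show "?\<gamma> t \<in> annulus r R"
      unfolding annulus_def mem_Collect_eq cm using assms by (auto simp: algebra_simps)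
  next
    have "isCont ?\<gamma> 0" "isCont ?\<gamma> 1" by (intro continuous_intros)+
    then have "(?\<gamma> \<longlongrightarrow> ?\<gamma> 0) (at_right 0)" "(?\<gamma> \<longlongrightarrow> ?\<gamma> 1) (at_left 1)"
      by (auto simp only: isCont_def intro: tendsto_mono[OF at_le[OF subset_UNIV]])
    moreover have "cmod (?\<gamma> 0) = r" "cmod (?\<gamma> 1) = R" unfolding cm using assms by auto
    ultimately show "\<exists>u v. (?\<gamma> \<longlongrightarrow> u) (at_right 0) \<and> (?\<gamma> \<longlongrightarrow> v) (at_left 1) \<and>
      (cmod u = r \<and> cmod v = R \<or> cmod u = R \<and> cmod v = r)" by blast
  qed
  then have "1 \<le> line_integral \<rho> ?\<gamma>"
    using adm locally_rectifiable_segment by (auto simp: admissible_def)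
  also have "\<dots> \<le> (\<integral>\<^sup>+s. \<rho> (of_real s * w) * indicator {r<..<R} s \<partial>lborel)"
    using adm assms by (intro line_integral_segment) (auto simp: admissible_def)
  finally show ?thesis .
qed

text \<open>Averages the bound for single radii over all directions. The weight
  \<open>1 / cmod z\<close> cancels the polar factor \<open>|s|\<close>, and each slope contributes
  two opposite rays, so the total is the integral of \<open>2 / (1 + m\<^sup>2)\<close>.\<close>

lemma nn_integral_admissible_ge:
  assumes adm: "admissible (joining_curves r R) \<rho>" and "0 < r" "r < R"
  shows "ennreal (2 * pi) \<le> (\<integral>\<^sup>+z. \<rho> z * ennreal (1 / cmod z) * indicator (annulus r R) z \<partial>lborel)"
proof -
  have [measurable]: "\<rho> \<in> borel_measurable borel" using adm by (simp add: admissible_def)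
  have "ennreal (2 * pi) = (\<integral>\<^sup>+m. ennreal (1 / (1 + m\<^sup>2)) * 2 \<partial>lborel)"
    by (subst nn_integral_multc) (auto simp: nn_integral_arctan ennreal_mult mult.commute)
  also have "\<dots> \<le> (\<integral>\<^sup>+m. ennreal (1 / (1 + m\<^sup>2)) * (\<integral>\<^sup>+s. ennreal \<bar>s\<bar> *
     (\<rho> (of_real s * ray m) * ennreal (1 / cmod (of_real s * ray m)) * indicator (annulus r R) (of_real s * ray m)) \<partial>lborel) \<partial>lborel)"
  proof (intro nn_integral_mono mult_left_mono)
    fix m :: real
    have "(2::ennreal) = 1 + 1" by simp
    also have "\<dots> \<le> (\<integral>\<^sup>+s. \<rho> (of_real s * ray m) * indicator {r<..<R} s \<partial>lborel) +
       (\<integral>\<^sup>+s. \<rho> (of_real s * (- ray m)) * indicator {r<..<R} s \<partial>lborel)"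
      using assms by (intro add_mono admissible_on_ray[OF adm]) auto
    also have "\<dots> = (\<integral>\<^sup>+s. \<rho> (of_real s * ray m) * indicator {r<..<R} s + \<rho> (of_real s * (- ray m)) * indicator {r<..<R} s \<partial>lborel)"
      by (rule nn_integral_add[symmetric]) auto
    also have "\<dots> \<le> (\<integral>\<^sup>+s. ennreal \<bar>s\<bar> *
     (\<rho> (of_real s * ray m) * ennreal (1 / cmod (of_real s * ray m)) * indicator (annulus r R) (of_real s * ray m)) \<partial>lborel)"
    proof (subst (2) nn_integral_even, measurable, intro nn_integral_mono)
      fix s :: real
      have "\<rho> z = ennreal s * (\<rho> z * ennreal (1 / s))" if "s > 0" for z
      proof -
        have "ennreal s * (\<rho> z * ennreal (1 / s)) = (ennreal s * ennreal (1 / s)) * \<rho> z" by (simp only: mult_ac)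
        also have "ennreal s * ennreal (1 / s) = 1" using that by (subst ennreal_mult[symmetric]) auto
        finally show ?thesis by simp
      qed
      then show "\<rho> (of_real s * ray m) * indicator {r<..<R} s + \<rho> (of_real s * (- ray m)) * indicator {r<..<R} s
        \<le> (ennreal \<bar>s\<bar> * (\<rho> (of_real s * ray m) * ennreal (1 / cmod (of_real s * ray m)) * indicator (annulus r R) (of_real s * ray m)) +
           ennreal \<bar>- s\<bar> * (\<rho> (of_real (- s) * ray m) * ennreal (1 / cmod (of_real (- s) * ray m)) * indicator (annulus r R) (of_real (- s) * ray m)))
          * indicator {0<..} s"
        using assms by (auto simp: indicator_def annulus_def norm_mult)
    qed
    finally show "2 \<le> (\<integral>\<^sup>+s. ennreal \<bar>s\<bar> *
     (\<rho> (of_real s * ray m) * ennreal (1 / cmod (of_real s * ray m)) * indicator (annulus r R) (of_real s * ray m)) \<partial>lborel)" .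
  qed simp
  also have "\<dots> = (\<integral>\<^sup>+z. \<rho> z * ennreal (1 / cmod z) * indicator (annulus r R) z \<partial>lborel)"
    by (rule nn_integral_polar[symmetric]) measurable
  finally show ?thesis .
qed

section \<open>Radial weights in the logarithmic coordinate\<close>

locale radial_profile =
  fixes h H :: "real \<Rightarrow> real" and r R :: real
  assumes h_meas [measurable]: "h \<in> borel_measurable borel" and r: "0 < r" "r < R"
    and deriv: "\<And>x. ln (1 / R) \<le> x \<Longrightarrow> x \<le> ln (1 / r) \<Longrightarrow> (H has_real_derivative h x) (at x)"
    and h_pos: "\<And>x. ln (1 / R) \<le> x \<Longrightarrow> x \<le> ln (1 / r) \<Longrightarrow> 0 < h x"
begin

text \<open>With the primitive \<open>H\<close> part of the data, the integral of \<open>h\<close>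
  is an increment of \<open>H\<close>, and the main terms of the asymptotics can be inserted
  directly.\<close>

definition N :: real where "N = H (ln (1 / r)) - H (ln (1 / R))"

lemma ln_bounds: "r \<le> s \<Longrightarrow> s \<le> R \<Longrightarrow> ln (1 / R) \<le> ln (1 / s)" "r \<le> s \<Longrightarrow> s \<le> R \<Longrightarrow> ln (1 / s) \<le> ln (1 / r)"
  using r by (auto simp: frac_le)

lemma N_pos: "0 < N"
proof -
  have "ln (1 / R) < ln (1 / r)" using r by (auto simp: frac_less2)
  then show ?thesis
    unfolding N_def using deriv h_pos DERIV_pos_imp_increasing[of "ln (1 / R)" "ln (1 / r)" H] by force
qed

lemma profile_deriv:
  assumes "r \<le> s" "s \<le> R"
  shows "((\<lambda>s. H (ln (1 / s))) has_real_derivative - (h (ln (1 / s)) / s)) (at s)"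
proof -
  have "((\<lambda>s. ln (1 / s)) has_real_derivative - (1 / s)) (at s)"
    using assms r by (auto intro!: derivative_eq_intros simp: field_simps power2_eq_square)
  from DERIV_chain2[where f = H and g = "\<lambda>s. ln (1 / s)", OF deriv[OF ln_bounds[OF assms]] this]
  show ?thesis by simp
qed

text \<open>The polar factor s turns \<open>1 / s\<^sup>2\<close> into \<open>1 / s\<close>, and
  \<open>ds / s\<close> is \<open>dx\<close> up to sign, so the radial integral is the increment of
  \<open>H\<close>.\<close>

lemma nn_integral_profile:
  "(\<integral>\<^sup>+z. ennreal (h (ln (1 / cmod z)) / (cmod z)\<^sup>2) * indicator (annulus r R) z \<partial>lborel) = ennreal (2 * pi * N)"
proof -
  have pos: "0 < h (ln (1 / s))" if "r \<le> s" "s \<le> R" for s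
    using h_pos ln_bounds that by blast
  have "(\<integral>\<^sup>+z. ennreal (h (ln (1 / cmod z)) / (cmod z)\<^sup>2) * indicator (annulus r R) z \<partial>lborel)
    = (\<integral>\<^sup>+z. ennreal (h (ln (1 / cmod z)) / (cmod z)\<^sup>2) * indicator {r<..<R} (cmod z) \<partial>lborel)"
    by (intro nn_integral_cong) (auto simp: indicator_def annulus_def)
  also have "\<dots> = ennreal (2 * pi) * (\<integral>\<^sup>+s. ennreal s * (ennreal (h (ln (1 / s)) / s\<^sup>2) * indicator {r<..<R} s) * indicator {0<..} s \<partial>lborel)"
    by (rule nn_integral_radial) measurable
  also have "(\<integral>\<^sup>+s. ennreal s * (ennreal (h (ln (1 / s)) / s\<^sup>2) * indicator {r<..<R} s) * indicator {0<..} s \<partial>lborel)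
     = (\<integral>\<^sup>+s. ennreal (h (ln (1 / s)) / s) * indicator {r..R} s \<partial>lborel)"
  proof (rule nn_integral_cong_AE, rule AE_mp[OF AE_lborel_singleton[of r]], rule AE_mp[OF AE_lborel_singleton[of R]], intro AE_I2 impI)
    fix s assume "s \<noteq> R" "s \<noteq> r"
    moreover have "ennreal s * ennreal (h (ln (1 / s)) / s\<^sup>2) = ennreal (h (ln (1 / s)) / s)" if s: "r < s" "s < R"
    proof -
      have "0 < h (ln (1 / s))" using pos[of s] s by simp
      then show ?thesis
        using s r by (subst ennreal_mult[symmetric]) (auto simp: power2_eq_square)
    qed
    ultimately show "ennreal s * (ennreal (h (ln (1 / s)) / s\<^sup>2) * indicator {r<..<R} s) * indicator {0<..} s
      = ennreal (h (ln (1 / s)) / s) * indicator {r..R} s"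
      using r by (cases "r < s \<and> s < R") (auto simp: indicator_def simp flip: mult.assoc)
  qed
  also have "\<dots> = ennreal (- H (ln (1 / R)) - - H (ln (1 / r)))"
  proof (rule nn_integral_FTC_Icc)
    fix s assume "s \<in> {r..R}"
    then have s: "r \<le> s" "s \<le> R" by auto
    show "((\<lambda>s. - H (ln (1 / s))) has_real_derivative h (ln (1 / s)) / s) (at s)"
      using DERIV_minus[OF profile_deriv[OF s]] by simp
    show "0 \<le> h (ln (1 / s)) / s" using pos[OF s] s r by auto
  qed (use r in auto)
  also have "ennreal (2 * pi) * \<dots> = ennreal (2 * pi * N)"
    using N_pos by (subst ennreal_mult[symmetric]) (auto simp: N_def)
  finally show ?thesis .
qed

lemma profile_pos: "z \<in> annulus r R \<Longrightarrow> 0 < h (ln (1 / cmod z))"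
  using ln_bounds[of "cmod z"] by (intro h_pos) (auto simp: annulus_def)

text \<open>Dividing by \<open>N\<close> makes the primitive \<open>- H (ln (1 / s)) / N\<close>
  rise by exactly 1 from r to R.\<close>

lemma admissible_profile:
  assumes "\<And>x. ln (1 / R) < x \<Longrightarrow> x < ln (1 / r) \<Longrightarrow> isCont h x"
  shows "admissible (joining_curves r R) (\<lambda>z. ennreal (h (ln (1 / cmod z)) / (cmod z * N)) * indicator (annulus r R) z)"
proof (rule admissible_radial[where f = "\<lambda>s. h (ln (1 / s)) / (s * N)" and F = "\<lambda>s. - H (ln (1 / s)) / N"])
  have F: "((\<lambda>s. - H (ln (1 / s)) / N) has_real_derivative h (ln (1 / s)) / (s * N)) (at s)" if "r \<le> s" "s \<le> R" for s
    using DERIV_cdivide[OF DERIV_minus[OF profile_deriv[OF that]], of N] by simp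
  show "isCont (\<lambda>s. - H (ln (1 / s)) / N) r" "isCont (\<lambda>s. - H (ln (1 / s)) / N) R"
    using r by (intro DERIV_isCont[OF F]; simp)+
  show "1 \<le> - H (ln (1 / R)) / N - - H (ln (1 / r)) / N"
    using N_pos by (simp add: N_def flip: diff_divide_distrib)
  fix s assume s: "r < s" "s < R"
  then show "((\<lambda>s. - H (ln (1 / s)) / N) has_real_derivative h (ln (1 / s)) / (s * N)) (at s)" by (intro F) auto
  show "0 < h (ln (1 / s)) / (s * N)" using s r N_pos h_pos[OF ln_bounds[of s]] by auto
  have "isCont (\<lambda>s. ln (1 / s)) s" using s r by (auto intro!: continuous_intros)
  moreover have "isCont h (ln (1 / s))" by (rule assms) (use s r in \<open>auto simp: frac_less2\<close>)
  ultimately have "isCont (\<lambda>s. h (ln (1 / s))) s" by (rule isCont_o2)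
  then show "isCont (\<lambda>s. h (ln (1 / s)) / (s * N)) s" using s r N_pos by (intro continuous_intros) auto
qed measurable

text \<open>Cauchy-Schwarz in pointwise form. For the weight K = 1/h and the extremal density
  \<open>\<rho>0\<close>, expanding the square of the difference gives 2 \<rho>
  \<open>\<rho>0\<close> K \<le> \<rho>^2 K + \<open>\<rho>0\<close>^2 K. Since
  \<open>\<rho>0\<close> K = 1/(|z| N), the left side is linear in \<rho> and integrates to at least
  4 pi/N, while the last term integrates to 2 pi/N; subtracting leaves 2 pi/N.\<close>

lemma weighted_modulus_ge:
  assumes adm: "admissible (joining_curves r R) \<rho>"
  shows "ennreal (2 * pi / N) \<le> (\<integral>\<^sup>+z. (\<rho> z)\<^sup>2 * (ennreal (1 / h (ln (1 / cmod z))) * indicator (annulus r R) z) \<partial>lebesgue)"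
    (is "_ \<le> ?X")
proof -
  have [measurable]: "\<rho> \<in> borel_measurable borel" using adm by (simp add: admissible_def)
  define \<rho>0 where "\<rho>0 z = h (ln (1 / cmod z)) / (cmod z * N)" for z :: complex
  have [measurable]: "\<rho>0 \<in> borel_measurable borel" unfolding \<rho>0_def by measurable
  let ?K = "\<lambda>z. ennreal (1 / h (ln (1 / cmod z)))" and ?A = "\<lambda>z. indicator (annulus r R) z :: ennreal"
  have X: "?X = (\<integral>\<^sup>+z. (\<rho> z)\<^sup>2 * (?K z * ?A z) \<partial>lborel)"
    by (rule nn_integral_completion)
  have "ennreal (2 / N) * ennreal (2 * pi) \<le> ennreal (2 / N) * (\<integral>\<^sup>+z. \<rho> z * ennreal (1 / cmod z) * ?A z \<partial>lborel)"
    by (intro mult_left_mono nn_integral_admissible_ge[OF adm] r) auto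
  also have "\<dots> = (\<integral>\<^sup>+z. ennreal (2 / N) * (\<rho> z * ennreal (1 / cmod z) * ?A z) \<partial>lborel)"
    by (rule nn_integral_cmult[symmetric]) measurable
  also have "\<dots> \<le> (\<integral>\<^sup>+z. (\<rho> z)\<^sup>2 * (?K z * ?A z) +
      ennreal (1 / N\<^sup>2) * (ennreal (h (ln (1 / cmod z)) / (cmod z)\<^sup>2) * ?A z) \<partial>lborel)"
  proof (intro nn_integral_mono)
    fix z
    show "ennreal (2 / N) * (\<rho> z * ennreal (1 / cmod z) * ?A z) \<le>
      (\<rho> z)\<^sup>2 * (?K z * ?A z) + ennreal (1 / N\<^sup>2) * (ennreal (h (ln (1 / cmod z)) / (cmod z)\<^sup>2) * ?A z)"
    proof (cases "z \<in> annulus r R")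
      case True
      define k where "k = h (ln (1 / cmod z))"
      have k: "0 < k" "0 < cmod z" using profile_pos[OF True] True r by (auto simp: annulus_def k_def)
      show ?thesis
      proof (cases "\<rho> z")
        case (real x)
        have "0 \<le> (x - k / (cmod z * N))\<^sup>2 * (1 / k)" using k by auto
        also have "\<dots> = x\<^sup>2 * (1 / k) + 1 / N\<^sup>2 * (k / (cmod z)\<^sup>2) - 2 / N * (x * (1 / cmod z))"
          using k N_pos by (simp add: power2_eq_square field_simps)
        finally have "2 / N * (x * (1 / cmod z)) \<le> x\<^sup>2 * (1 / k) + 1 / N\<^sup>2 * (k / (cmod z)\<^sup>2)" by simp
        then have "ennreal (2 / N * (x * (1 / cmod z))) \<le> ennreal (x\<^sup>2 * (1 / k) + 1 / N\<^sup>2 * (k / (cmod z)\<^sup>2))"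
          by (rule ennreal_leI)
        also have "\<dots> = ennreal (x\<^sup>2) * ennreal (1 / k) + ennreal (1 / N\<^sup>2) * ennreal (k / (cmod z)\<^sup>2)"
          using k by (simp add: ennreal_plus[symmetric] ennreal_mult[symmetric] del: ennreal_plus)
        also have "ennreal (2 / N * (x * (1 / cmod z))) = ennreal (2 / N) * (ennreal x * ennreal (1 / cmod z))"
          using k real N_pos by (simp add: ennreal_mult flip: ennreal_mult)
        finally show ?thesis using True real by (simp add: k_def flip: ennreal_power)
      next
        case top
        then show ?thesis using True k by (simp add: k_def ennreal_top_mult power2_eq_square)
      qed
    qed simp
  qed
  also have "\<dots> = ?X + ennreal (1 / N\<^sup>2) * ennreal (2 * pi * N)"
    unfolding X nn_integral_profile[symmetric] by (simp add: nn_integral_add nn_integral_cmult)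
  also have "ennreal (1 / N\<^sup>2) * ennreal (2 * pi * N) = ennreal (2 * pi / N)"
    using N_pos by (subst ennreal_mult[symmetric]) (auto simp: power2_eq_square)
  also have "ennreal (2 / N) * ennreal (2 * pi) = ennreal (2 * pi / N + 2 * pi / N)"
    using N_pos by (subst ennreal_mult[symmetric]) auto
  finally show ?thesis
    using N_pos by (cases ?X) (auto simp flip: ennreal_plus)
qed

lemma weighted_modulus_le:
  assumes h_cont: "\<And>x. ln (1 / R) < x \<Longrightarrow> x < ln (1 / r) \<Longrightarrow> isCont h x"
    and [measurable]: "\<psi> \<in> borel_measurable borel" and "0 < c"
    and \<psi>: "\<And>x k. ln (1 / R) \<le> x \<Longrightarrow> x \<le> ln (1 / r) \<Longrightarrow> 1 \<le> k \<Longrightarrow> 1 / h x \<le> k \<Longrightarrow>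
      ennreal (c * k * (h x)\<^sup>2 * exp (2 * x)) \<le> \<psi> k"
    and K [measurable]: "K \<in> borel_measurable (lebesgue_on (annulus r R))"
    and K1: "\<And>z. z \<in> annulus r R \<Longrightarrow> 1 \<le> K z"
    and I: "0 \<le> I" "(\<integral>\<^sup>+z\<in>annulus r R. \<psi> (K z) \<partial>lebesgue) \<le> ennreal I"
  shows "weighted_modulus (\<lambda>z. ennreal (K z) * indicator (annulus r R) z) (joining_curves r R)
     \<le> ennreal (2 * pi / N + I / (c * N\<^sup>2))"
proof -
  let ?A = "\<lambda>z. indicator (annulus r R) z :: ennreal"
  have [measurable]: "annulus r R \<in> sets lebesgue" using borel_annulus by simp
  have m1: "(\<lambda>z. \<psi> (K z)) \<in> borel_measurable (lebesgue_on (annulus r R))" by measurable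
  \<comment> \<open>K is measurable only on the annulus, so the composite must be cut off there
    before it can be integrated over the plane.\<close>
  have m2: "(\<lambda>z. \<psi> (K z) * ?A z) \<in> borel_measurable lebesgue"
    using m1 by (subst (asm) borel_measurable_restrict_space_iff_ennreal) auto
  have m3: "(\<lambda>z. ennreal (h (ln (1 / cmod z)) / (cmod z)\<^sup>2) * ?A z) \<in> borel_measurable lborel" by measurable
  have "weighted_modulus (\<lambda>z. ennreal (K z) * ?A z) (joining_curves r R)
    \<le> (\<integral>\<^sup>+z. (ennreal (h (ln (1 / cmod z)) / (cmod z * N)) * ?A z)\<^sup>2 * (ennreal (K z) * ?A z) \<partial>lebesgue)"
    unfolding weighted_modulus_def using admissible_profile[OF h_cont] by (intro INF_lower) auto
  also have "\<dots> \<le> (\<integral>\<^sup>+z. ennreal (1 / N\<^sup>2) * (ennreal (h (ln (1 / cmod z)) / (cmod z)\<^sup>2) * ?A z)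
      + ennreal (1 / (c * N\<^sup>2)) * (\<psi> (K z) * ?A z) \<partial>lebesgue)"
  proof (intro nn_integral_mono)
    fix z
    show "(ennreal (h (ln (1 / cmod z)) / (cmod z * N)) * ?A z)\<^sup>2 * (ennreal (K z) * ?A z) \<le>
      ennreal (1 / N\<^sup>2) * (ennreal (h (ln (1 / cmod z)) / (cmod z)\<^sup>2) * ?A z)
      + ennreal (1 / (c * N\<^sup>2)) * (\<psi> (K z) * ?A z)"
    proof (cases "z \<in> annulus r R")
      case True
      define x where "x = ln (1 / cmod z)"
      have z: "0 < cmod z" using True r by (auto simp: annulus_def)
      have x: "ln (1 / R) \<le> x" "x \<le> ln (1 / r)" using True ln_bounds[of "cmod z"] by (auto simp: x_def annulus_def)
      have h: "h x > 0" using h_pos x by auto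
      have e: "exp (2 * x) = 1 / (cmod z)\<^sup>2"
        using z by (simp only: exp_double) (simp add: x_def exp_ln power_one_over del: ln_divide_pos ln_div ln_inverse)
      have eq: "(ennreal (h x / (cmod z * N)))\<^sup>2 * ennreal (K z) = ennreal (K z * (h x)\<^sup>2 / ((cmod z)\<^sup>2 * N\<^sup>2))"
      proof -
        have "(ennreal (h x / (cmod z * N)))\<^sup>2 * ennreal (K z) = ennreal ((h x / (cmod z * N))\<^sup>2 * K z)"
          using h z N_pos K1[OF True] by (subst ennreal_power) (auto simp: ennreal_mult)
        also have "(h x / (cmod z * N))\<^sup>2 * K z = K z * (h x)\<^sup>2 / ((cmod z)\<^sup>2 * N\<^sup>2)"
          by (simp add: power_divide power_mult_distrib)
        finally show ?thesis .
      qed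
      show ?thesis
      \<comment> \<open>Above the threshold 1/h the growth hypothesis on \<psi> makes the second
        summand large enough. Below it K h \<le> 1, hence K h^2 \<le> h, and the first summand
        suffices.\<close>
      proof (cases "1 / h x \<le> K z")
        case True': True
        have "ennreal (K z * (h x)\<^sup>2 / ((cmod z)\<^sup>2 * N\<^sup>2)) = ennreal (1 / (c * N\<^sup>2)) * ennreal (c * K z * (h x)\<^sup>2 * exp (2 * x))"
          using h z N_pos K1[OF True] \<open>c > 0\<close> by (subst ennreal_mult[symmetric]) (auto simp: e)
        also have "\<dots> \<le> ennreal (1 / (c * N\<^sup>2)) * \<psi> (K z)"
          using \<psi>[OF x K1[OF True] True'] by (intro mult_left_mono) auto
        finally show ?thesis using True eq by (simp add: x_def add_increasing)
      next
        case False
        then have "K z * h x \<le> 1" using h by (simp add: field_simps)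
        then have "(K z * h x) * h x \<le> 1 * h x" using h by (intro mult_right_mono) auto
        then have "K z * (h x)\<^sup>2 / ((cmod z)\<^sup>2 * N\<^sup>2) \<le> 1 / N\<^sup>2 * (h x / (cmod z)\<^sup>2)"
          using z N_pos by (simp add: power2_eq_square divide_right_mono mult.commute mult.left_commute)
        then have "ennreal (K z * (h x)\<^sup>2 / ((cmod z)\<^sup>2 * N\<^sup>2)) \<le> ennreal (1 / N\<^sup>2) * ennreal (h x / (cmod z)\<^sup>2)"
          using h by (subst ennreal_mult[symmetric]) (auto intro: ennreal_leI)
        then show ?thesis using True eq by (simp add: x_def add_increasing2)
      qed
    qed simp
  qed
  also have "\<dots> = ennreal (1 / N\<^sup>2) * (\<integral>\<^sup>+z. (ennreal (h (ln (1 / cmod z)) / (cmod z)\<^sup>2) * ?A z) \<partial>lborel)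
      + ennreal (1 / (c * N\<^sup>2)) * (\<integral>\<^sup>+z. \<psi> (K z) * ?A z \<partial>lebesgue)"
    using m2 measurable_completion[OF m3]
    by (simp add: nn_integral_add nn_integral_cmult flip: nn_integral_completion[of lborel])
  also have "\<dots> \<le> ennreal (1 / N\<^sup>2) * ennreal (2 * pi * N) + ennreal (1 / (c * N\<^sup>2)) * ennreal I"
    unfolding nn_integral_profile using I by (intro add_mono mult_left_mono) auto
  also have "\<dots> = ennreal (2 * pi / N + I / (c * N\<^sup>2))"
    using N_pos I \<open>c > 0\<close> by (simp add: power2_eq_square flip: ennreal_mult ennreal_plus)
  finally show ?thesis .
qed


lemma conditional_modulus_ge:
  assumes "R < 1"
    and h_le: "\<And>x. ln (1 / R) \<le> x \<Longrightarrow> x \<le> ln (1 / r) \<Longrightarrow> h x \<le> 1"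
    and \<psi>: "\<And>x. ln (1 / R) \<le> x \<Longrightarrow> x \<le> ln (1 / r) \<Longrightarrow> \<psi> (1 / h x) \<le> ennreal (exp (2 * x) / x\<^sup>2)"
    and I: "2 * pi / ln (1 / R) \<le> I"
  shows "ennreal (2 * pi / N) \<le> conditional_modulus \<psi> I (annulus r R) (joining_curves r R)"
proof -
  let ?A = "\<lambda>z. indicator (annulus r R) z :: ennreal"
  have lnR: "0 < ln (1 / R)" "ln (1 / R) < ln (1 / r)" using r \<open>R < 1\<close> by (auto simp: frac_less2)
  \<comment> \<open>The constraint integral of \<open>exp (2 * x) / x\<^sup>2\<close> is itself a
    profile integral, with profile \<open>1 / x\<^sup>2\<close>. Its increment is at most
    \<open>1 / ln (1 / R)\<close>, a bound that does not involve r.\<close>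
  interpret Q: radial_profile "\<lambda>x. 1 / x\<^sup>2" "\<lambda>x. - (1 / x)" r R
  proof
    fix x assume "ln (1 / R) \<le> x"
    with lnR(1) have "0 < x" by (rule less_le_trans)
    then show "((\<lambda>x. - (1 / x)) has_real_derivative 1 / x\<^sup>2) (at x)" "0 < 1 / x\<^sup>2"
      by (auto intro!: derivative_eq_intros simp: power2_eq_square)
  qed (use r in auto)
  have "(\<integral>\<^sup>+z\<in>annulus r R. \<psi> (1 / h (ln (1 / cmod z))) \<partial>lebesgue)
      \<le> (\<integral>\<^sup>+z. ennreal (1 / (ln (1 / cmod z))\<^sup>2 / (cmod z)\<^sup>2) * ?A z \<partial>lebesgue)"
  proof (intro nn_integral_mono)
    fix z
    show "\<psi> (1 / h (ln (1 / cmod z))) * ?A z \<le> ennreal (1 / (ln (1 / cmod z))\<^sup>2 / (cmod z)\<^sup>2) * ?A z"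
    proof (cases "z \<in> annulus r R")
      case True
      define x where "x = ln (1 / cmod z)"
      have z: "0 < cmod z" using True r by (auto simp: annulus_def)
      have x: "ln (1 / R) \<le> x" "x \<le> ln (1 / r)" using True ln_bounds[of "cmod z"] by (auto simp: x_def annulus_def)
      have "exp (2 * x) = 1 / (cmod z)\<^sup>2"
        using z by (simp only: exp_double) (simp add: x_def exp_ln power_one_over del: ln_divide_pos ln_div ln_inverse)
      then show ?thesis using True \<psi>[OF x] by (simp add: x_def mult.commute)
    qed simp
  qed
  also have "\<dots> = ennreal (2 * pi * Q.N)"
    by (subst nn_integral_completion) (rule Q.nn_integral_profile)
  also have "\<dots> \<le> ennreal I"
  proof (rule ennreal_leI)
    have "Q.N \<le> 1 / ln (1 / R)" using lnR by (simp add: Q.N_def)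
    then have "2 * pi * Q.N \<le> 2 * pi * (1 / ln (1 / R))" by (intro mult_left_mono) auto
    then show "2 * pi * Q.N \<le> I" using I by simp
  qed
  finally have int: "(\<integral>\<^sup>+z\<in>annulus r R. \<psi> (1 / h (ln (1 / cmod z))) \<partial>lebesgue) \<le> ennreal I" .
  have "ennreal (2 * pi / N) \<le>
      weighted_modulus (\<lambda>z. ennreal (1 / h (ln (1 / cmod z))) * ?A z) (joining_curves r R)"
    unfolding weighted_modulus_def by (intro INF_greatest) (auto intro: weighted_modulus_ge)
  also have "\<dots> \<le> conditional_modulus \<psi> I (annulus r R) (joining_curves r R)"
    unfolding conditional_modulus_def
  proof (rule SUP_upper, safe)
    show "(\<lambda>z. 1 / h (ln (1 / cmod z))) \<in> borel_measurable (lebesgue_on (annulus r R))"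
    proof -
      have "(\<lambda>z::complex. 1 / h (ln (1 / cmod z))) \<in> borel_measurable lborel" by measurable
      then show ?thesis by (intro measurable_restrict_space1 measurable_completion)
    qed
    show "1 \<le> 1 / h (ln (1 / cmod z))" if "z \<in> annulus r R" for z
      using profile_pos[OF that] h_le[OF ln_bounds[of "cmod z"]] that by (simp add: annulus_def)
  qed (rule int)
  finally show ?thesis .
qed

lemma conditional_modulus_le:
  assumes "\<And>x. ln (1 / R) < x \<Longrightarrow> x < ln (1 / r) \<Longrightarrow> isCont h x"
    and "\<psi> \<in> borel_measurable borel" and "0 < c" and "0 \<le> I"
    and "\<And>x k. ln (1 / R) \<le> x \<Longrightarrow> x \<le> ln (1 / r) \<Longrightarrow> 1 \<le> k \<Longrightarrow> 1 / h x \<le> k \<Longrightarrow>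
      ennreal (c * k * (h x)\<^sup>2 * exp (2 * x)) \<le> \<psi> k"
  shows "conditional_modulus \<psi> I (annulus r R) (joining_curves r R) \<le> ennreal (2 * pi / N + I / (c * N\<^sup>2))"
  unfolding conditional_modulus_def
  by (rule SUP_least) (use assms in \<open>auto intro!: weighted_modulus_le\<close>)

end

text \<open>Uniformity in r rests on the elementary bound 2 pi / (2 pi/N + I/(c N^2)) \<ge> N - I/(2
  pi c): the loss is independent of N, whether r is close to R and N is small, or r tends to 0. The
  thresholds on R depend on c and on the profiles, never on r.\<close>

theorem modulus_asymptoticsI:
  fixes G hl Hl hu Hu :: "real \<Rightarrow> real"
  assumes "0 < I" and \<psi>_meas: "\<psi> \<in> borel_measurable borel"
    and hl_meas: "hl \<in> borel_measurable borel" and hu_meas: "hu \<in> borel_measurable borel"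
    and lower: "\<forall>\<^sub>F x in at_top. (Hl has_real_derivative hl x) (at x)" "\<forall>\<^sub>F x in at_top. 0 < hl x"
      "\<forall>\<^sub>F x in at_top. hl x \<le> 1" "\<forall>\<^sub>F x in at_top. \<psi> (1 / hl x) \<le> ennreal (exp (2 * x) / x\<^sup>2)"
    and lower_lim: "((\<lambda>x. Hl x - G x) \<longlongrightarrow> 0) at_top"
    and upper: "\<forall>\<^sub>F x in at_top. (Hu has_real_derivative hu x) (at x)" "\<forall>\<^sub>F x in at_top. 0 < hu x"
      "\<forall>\<^sub>F x in at_top. isCont hu x"
      "\<And>c. 0 < c \<Longrightarrow> \<forall>\<^sub>F x in at_top. \<forall>k\<ge>1. 1 / hu x \<le> k \<longrightarrow> ennreal (c * k * (hu x)\<^sup>2 * exp (2 * x)) \<le> \<psi> k"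
    and upper_lim: "((\<lambda>x. Hu x - G x) \<longlongrightarrow> 0) at_top"
  shows "modulus_asymptotics \<psi> I (\<lambda>r R. G (ln (1 / r)) - G (ln (1 / R)))"
proof -
  define M where "M r R = conditional_modulus \<psi> I (annulus r R) (joining_curves r R)" for r R
  let ?D = "\<lambda>H r R. H (ln (1 / r)) - H (ln (1 / R)) :: real"
  have ln_gt: "x < ln (1 / s)" if "0 < s" "s < exp (- x)" for x s :: real
  proof -
    have "ln s < - x" using that by (metis ln_exp ln_less_cancel_iff exp_gt_zero)
    then show ?thesis using that by (simp add: ln_div)
  qed
  from lower have "\<forall>\<^sub>F x in at_top. (Hl has_real_derivative hl x) (at x) \<and> 0 < hl x \<and> hl x \<le> 1 \<and> \<psi> (1 / hl x) \<le> ennreal (exp (2 * x) / x\<^sup>2)"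
    by eventually_elim auto
  then obtain X0 where X0: "\<And>x. X0 \<le> x \<Longrightarrow> (Hl has_real_derivative hl x) (at x) \<and> 0 < hl x \<and> hl x \<le> 1 \<and> \<psi> (1 / hl x) \<le> ennreal (exp (2 * x) / x\<^sup>2)"
    unfolding eventually_at_top_linorder by blast
  \<comment> \<open>The entry 0 ensures R < 1, and \<open>2 * pi / I\<close> makes the constraint
    integral fit into the budget I.\<close>
  define X1 where "X1 = Max {0, X0, 2 * pi / I}"
  have X1: "0 \<le> X1" "X0 \<le> X1" "2 * pi / I \<le> X1" by (auto simp: X1_def)
  have A: "0 < ?D Hl r R \<and> ennreal (2 * pi / ?D Hl r R) \<le> M r R" if rR: "0 < r" "r < R" "R < exp (- X1)" for r R
  proof -
    have lnR: "X1 < ln (1 / R)" using rR by (intro ln_gt) auto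
    interpret radial_profile hl Hl r R
      by unfold_locales (use rR lnR X0 X1 hl_meas in auto)
    have "2 * pi / I < ln (1 / R)" using lnR X1 by linarith
    then have "2 * pi / ln (1 / R) \<le> I" using \<open>0 < I\<close> lnR X1 by (simp add: field_simps)
    moreover have "R < 1" using rR X1(1) by (meson exp_le_one_iff neg_le_0_iff_le less_le_trans)
    ultimately have "ennreal (2 * pi / N) \<le> M r R"
      unfolding M_def by (intro conditional_modulus_ge) (use lnR X0 X1 in auto)
    then show ?thesis using N_pos by (simp add: N_def)
  qed
  have B: "\<exists>X. \<forall>r R. 0 < r \<longrightarrow> r < R \<longrightarrow> R < exp (- X) \<longrightarrow>
      0 < ?D Hu r R \<and> M r R \<le> ennreal (2 * pi / ?D Hu r R + I / (c * (?D Hu r R)\<^sup>2))" if "0 < c" for c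
  proof -
    from upper(1-3) upper(4)[OF that]
    have "\<forall>\<^sub>F x in at_top. (Hu has_real_derivative hu x) (at x) \<and> 0 < hu x \<and> isCont hu x \<and>
        (\<forall>k\<ge>1. 1 / hu x \<le> k \<longrightarrow> ennreal (c * k * (hu x)\<^sup>2 * exp (2 * x)) \<le> \<psi> k)"
      by eventually_elim auto
    then obtain X where X: "\<And>x. X \<le> x \<Longrightarrow> (Hu has_real_derivative hu x) (at x) \<and> 0 < hu x \<and> isCont hu x \<and>
        (\<forall>k\<ge>1. 1 / hu x \<le> k \<longrightarrow> ennreal (c * k * (hu x)\<^sup>2 * exp (2 * x)) \<le> \<psi> k)"
      unfolding eventually_at_top_linorder by blast
    have "0 < ?D Hu r R \<and> M r R \<le> ennreal (2 * pi / ?D Hu r R + I / (c * (?D Hu r R)\<^sup>2))"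
      if rR: "0 < r" "r < R" "R < exp (- X)" for r R
    proof -
      have lnR: "X < ln (1 / R)" using rR by (intro ln_gt) auto
      interpret radial_profile hu Hu r R
        by unfold_locales (use rR lnR X hu_meas in auto)
      have "M r R \<le> ennreal (2 * pi / N + I / (c * N\<^sup>2))"
        unfolding M_def
        by (intro conditional_modulus_le \<psi>_meas \<open>0 < c\<close>) (use lnR X \<open>0 < I\<close> in auto)
      then show ?thesis using N_pos by (simp add: N_def)
    qed
    then show ?thesis by blast
  qed
  \<comment> \<open>The value c = 1 serves only to show that the modulus is finite, so that
    \<open>err\<close> can be defined from it.\<close>
  obtain X2 where X2: "\<And>r R. 0 < r \<Longrightarrow> r < R \<Longrightarrow> R < exp (- X2) \<Longrightarrow>
      0 < ?D Hu r R \<and> M r R \<le> ennreal (2 * pi / ?D Hu r R + I / (1 * (?D Hu r R)\<^sup>2))"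
    using B[OF zero_less_one] by blast
  define R0 where "R0 = min (exp (- X1)) (exp (- X2))"
  define m where "m r R = enn2real (M r R)" for r R
  have m: "0 < m r R" "M r R = ennreal (m r R)" if "0 < r" "r < R" "R < R0" for r R
  proof -
    have "0 < ennreal (2 * pi / ?D Hl r R)" "ennreal (2 * pi / ?D Hl r R) \<le> M r R"
      using A[of r R] that by (auto simp: R0_def)
    then have "0 < M r R" by order
    moreover have "M r R < top" using X2[of r R] that by (auto simp: R0_def intro: le_less_trans)
    ultimately show "0 < m r R" "M r R = ennreal (m r R)"
      by (auto simp: m_def enn2real_positive_iff)
  qed
  define err where "err r R = 2 * pi / m r R - ?D G r R" for r R
  have "\<exists>\<delta>>0. \<forall>r R. 0 < r \<and> r < R \<and> R < \<delta> \<longrightarrow> \<bar>err r R\<bar> < \<epsilon>" if "0 < \<epsilon>" for \<epsilon>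
  proof -
    have "\<forall>\<^sub>F x in at_top. \<bar>Hl x - G x\<bar> < \<epsilon> / 8 \<and> \<bar>Hu x - G x\<bar> < \<epsilon> / 8"
      using tendstoD[OF lower_lim, of "\<epsilon> / 8"] tendstoD[OF upper_lim, of "\<epsilon> / 8"] that
      by (auto simp: eventually_conj_iff)
    then obtain X3 where X3: "\<And>x. X3 \<le> x \<Longrightarrow> \<bar>Hl x - G x\<bar> < \<epsilon> / 8 \<and> \<bar>Hu x - G x\<bar> < \<epsilon> / 8"
      unfolding eventually_at_top_linorder by blast
    \<comment> \<open>Chosen so that the loss I/(2 pi c) equals \<epsilon>/2. Each primitive is
      within \<epsilon>/8 of \<open>G\<close> at both ends, so its increment is off by less than
      \<epsilon>/4, and the total stays below \<epsilon>.\<close>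
    define c where "c = I / (pi * \<epsilon>)"
    have c: "0 < c" "I / c = pi * \<epsilon>" using \<open>0 < I\<close> \<open>0 < \<epsilon>\<close> by (auto simp: c_def)
    obtain X4 where X4: "\<And>r R. 0 < r \<Longrightarrow> r < R \<Longrightarrow> R < exp (- X4) \<Longrightarrow>
      0 < ?D Hu r R \<and> M r R \<le> ennreal (2 * pi / ?D Hu r R + I / (c * (?D Hu r R)\<^sup>2))"
      using B[OF c(1)] by blast
    show ?thesis
    proof (intro exI[of _ "min R0 (min (exp (- X3)) (exp (- X4)))"] conjI allI impI)
      fix r R assume rR: "0 < r \<and> r < R \<and> R < min R0 (min (exp (- X3)) (exp (- X4)))"
      define nl nu where "nl = ?D Hl r R" and "nu = ?D Hu r R"
      have lnX3: "X3 \<le> ln (1 / R)" "X3 \<le> ln (1 / r)" 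
        using rR ln_gt[of R X3] ln_gt[of r X3] by auto
      have near: "\<bar>nl - ?D G r R\<bar> < \<epsilon> / 4" "\<bar>nu - ?D G r R\<bar> < \<epsilon> / 4"
        unfolding nl_def nu_def using X3[OF lnX3(1)] X3[OF lnX3(2)] by linarith+
      have m0: "0 < m r R" and M: "M r R = ennreal (m r R)" using m[of r R] rR by auto
      have nl: "0 < nl" "2 * pi / nl \<le> m r R"
        using A[of r R] rR M m0 by (auto simp: R0_def nl_def ennreal_le_iff)
      have nu: "0 < nu" "m r R \<le> 2 * pi / nu + I / (c * nu\<^sup>2)"
      proof -
        show "0 < nu" using X4[of r R] rR by (auto simp: nu_def)
        have "ennreal (m r R) \<le> ennreal (2 * pi / nu + I / (c * nu\<^sup>2))"
          using X4[of r R] rR M unfolding nu_def by auto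
        then show "m r R \<le> 2 * pi / nu + I / (c * nu\<^sup>2)"
          using \<open>0 < nu\<close> c \<open>0 < I\<close> by (subst (asm) ennreal_le_iff) auto
      qed
      have "2 * pi / m r R \<le> nl" using nl m0 by (simp add: field_simps)
      \<comment> \<open>For small \<open>nu\<close>, as when r is close to R, the left side is not
        positive. Otherwise multiply the bound on the modulus by \<open>nu - \<epsilon> / 2\<close>:
        the terms linear in \<epsilon> cancel and the quadratic one is negative.\<close>
      moreover have "nu - \<epsilon> / 2 \<le> 2 * pi / m r R"
      proof (cases "nu \<le> \<epsilon> / 2")
        case True
        then have "nu - \<epsilon> / 2 \<le> 0" by simp
        also have "0 \<le> 2 * pi / m r R" using m0 by simp
        finally show ?thesis .
      next
        case False
        have "I / (c * nu\<^sup>2) = (I / c) / nu\<^sup>2" by simp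
        then have "m r R \<le> 2 * pi / nu + pi * \<epsilon> / nu\<^sup>2" using nu c by simp
        then have "m r R * (nu - \<epsilon> / 2) \<le> (2 * pi / nu + pi * \<epsilon> / nu\<^sup>2) * (nu - \<epsilon> / 2)"
          using False by (intro mult_right_mono) auto
        also have "\<dots> = 2 * pi - pi * \<epsilon>\<^sup>2 / (2 * nu\<^sup>2)"
          using nu by (simp add: field_simps power2_eq_square)
        also have "\<dots> \<le> 2 * pi" by simp
        finally show ?thesis using m0 by (simp add: field_simps)
      qed
      ultimately show "\<bar>err r R\<bar> < \<epsilon>" unfolding err_def using near by linarith
    qed (auto simp: R0_def)
  qed
  moreover have "0 < err r R + ?D G r R \<and>
      conditional_modulus \<psi> I (annulus r R) (joining_curves r R) = ennreal (2 * pi / (err r R + ?D G r R))"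
    if "0 < r" "r < R" "R < R0" for r R
    using m[OF that] by (simp add: err_def flip: M_def)
  moreover have "0 < R0" by (simp add: R0_def)
  ultimately show ?thesis
    unfolding modulus_asymptotics_def by (intro exI[of _ err]) blast
qed

section \<open>Exponential and subexponential integrability\<close>

text \<open>One of the two factors h absorbs c, which is possible for any c far out because h tends
  to 0. What remains is \<open>k * h * exp (2 * x)\<close>, to be compared through its
  logarithm.\<close>

lemma exp_ge_of_log_ge:
  fixes x k h \<phi> c :: real
  assumes "0 < h" "c * h \<le> 1" "1 / h \<le> k" "2 * x + ln (k * h) \<le> \<phi>"
  shows "c * k * h\<^sup>2 * exp (2 * x) \<le> exp \<phi>"
proof -
  have "0 < k" using assms(1,3) by (meson divide_pos_pos less_le_trans zero_less_one)
  have "c * k * h\<^sup>2 * exp (2 * x) = (c * h) * (k * h * exp (2 * x))" by (simp add: power2_eq_square)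
  also have "\<dots> \<le> 1 * (k * h * exp (2 * x))"
    using assms(1,2) \<open>0 < k\<close> by (intro mult_right_mono) auto
  also have "\<dots> = exp (2 * x + ln (k * h))"
    using assms(1) \<open>0 < k\<close> by (simp add: exp_add)
  also have "\<dots> \<le> exp \<phi>" using assms(4) by simp
  finally show ?thesis .
qed

lemma exp_div_power2: "0 < x \<Longrightarrow> exp (2 * x) / x\<^sup>2 = exp (2 * x - 2 * ln x)" for x :: real
  by (simp add: exp_diff exp_double)

lemma psi_power_asymptotics:
  fixes p \<alpha> I :: real
  assumes "0 < I" "0 < p" "1 \<le> \<alpha>"
    and G: "\<forall>\<^sub>F x in at_top. (G has_real_derivative (p / 2) powr (1 / \<alpha>) * x powr - (1 / \<alpha>)) (at x)"
  shows "modulus_asymptotics (psi_power p \<alpha>) I (\<lambda>r R. G (ln (1 / r)) - G (ln (1 / R)))"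
proof -
  define a where "a = 1 / \<alpha>"
  define A where "A = (p / 2) powr a"
  define g where "g x = A * x powr - a" for x
  have a: "0 < a" "a \<le> 1" "a * \<alpha> = 1" and A: "0 < A" using assms by (auto simp: a_def A_def)
  have A_powr: "A powr \<alpha> = p / 2" using a assms by (simp add: A_def powr_powr)
  have g_pos: "0 < g x" if "0 < x" for x using A that by (simp add: g_def)
  \<comment> \<open>Here y is the ratio of the argument of \<psi> to the threshold 1/g; the exponent
    is its threshold value \<open>2 * x\<close> times \<open>y powr \<alpha>\<close>.\<close>
  have g_powr: "p * (y / g x) powr \<alpha> = 2 * x * y powr \<alpha>" if "0 < x" "0 < y" for x y
  proof -
    have "y / g x = y * x powr a / A" by (simp add: g_def powr_minus field_simps)
    then have "(y / g x) powr \<alpha> = y powr \<alpha> * (x powr a) powr \<alpha> / A powr \<alpha>"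
      using that A by (simp add: powr_mult powr_divide)
    also have "\<dots> = y powr \<alpha> * x / (p / 2)" using that a by (simp add: powr_powr A_powr)
    finally show ?thesis using assms by simp
  qed
  show ?thesis
  \<comment> \<open>\<open>\<psi> (1 / g x) = exp (2 x)\<close> exactly; the perturbation of \<open>g\<close> gains the factor \<open>x\<^sup>-\<^sup>2\<close>
    and has an integrable tail\<close>
  proof (rule modulus_asymptoticsI[where hl = "\<lambda>x. g x + x powr (- 1 - a / 2)"
      and Hl = "\<lambda>x. G x - 2 / a * x powr - (a / 2)" and hu = g and Hu = G])
    show "psi_power p \<alpha> \<in> borel_measurable borel" unfolding psi_power_def by measurable
    show "g \<in> borel_measurable borel" "(\<lambda>x. g x + x powr (- 1 - a / 2)) \<in> borel_measurable borel"
      unfolding g_def by measurable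
    show "\<forall>\<^sub>F x in at_top. (G has_real_derivative g x) (at x)"
      using G by (simp add: g_def A_def a_def)
    show "\<forall>\<^sub>F x in at_top. 0 < g x" using eventually_gt_at_top[of 0] by eventually_elim (rule g_pos)
    show "\<forall>\<^sub>F x in at_top. isCont g x"
      using eventually_gt_at_top[of 0] by eventually_elim (auto simp: g_def[abs_def] intro!: continuous_intros)
    show "((\<lambda>x. G x - G x) \<longlongrightarrow> 0) at_top" by simp
    have "((\<lambda>x. - (2 / a * x powr - (a / 2))) \<longlongrightarrow> 0) at_top" using a by real_asymp
    then show "((\<lambda>x. G x - 2 / a * x powr - (a / 2) - G x) \<longlongrightarrow> 0) at_top" by simp
    show "\<forall>\<^sub>F x in at_top. ((\<lambda>x. G x - 2 / a * x powr - (a / 2)) has_real_derivative g x + x powr (- 1 - a / 2)) (at x)"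
      using G eventually_gt_at_top[of 0]
    proof eventually_elim
      case (elim x)
      then have "(G has_real_derivative g x) (at x)" by (simp add: g_def A_def a_def)
      then show ?case using elim a by (auto intro!: derivative_eq_intros simp: minus_diff_commute)
    qed
    show "\<forall>\<^sub>F x in at_top. 0 < g x + x powr (- 1 - a / 2)"
      using eventually_gt_at_top[of 0] by eventually_elim (auto intro: add_pos_nonneg g_pos)
    show "\<forall>\<^sub>F x in at_top. g x + x powr (- 1 - a / 2) \<le> 1"
      unfolding g_def using a A by real_asymp
    \<comment> \<open>The relative perturbation of \<open>g\<close> has order
      \<open>x powr (a / 2 - 1)\<close>. It lowers \<open>2 * x\<close> by about
      \<open>2 * x powr (a / 2) / A\<close>, which dominates \<open>2 * ln x\<close>. The exponent
      \<open>- 1 - a / 2\<close> lies between \<open>- 1 - a\<close>, where this gain would be lost,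
      and -1, where integrability of the tail would be.\<close>
    have "\<forall>\<^sub>F x in at_top. 2 * x / (1 + x powr (a / 2 - 1) / A) \<le> 2 * x - 2 * ln x"
    proof -
      have "a / 2 - 1 < 0" using a by simp
      with a A show ?thesis by real_asymp
    qed
    then show "\<forall>\<^sub>F x in at_top. psi_power p \<alpha> (1 / (g x + x powr (- 1 - a / 2))) \<le> ennreal (exp (2 * x) / x\<^sup>2)"
      using eventually_gt_at_top[of 0]
    proof eventually_elim
      case (elim x)
      define d where "d = x powr (a / 2 - 1) / A"
      have d: "0 \<le> d" using A by (simp add: d_def)
      have "x powr (- 1 - a / 2) = x powr - a * x powr (a / 2 - 1)"
        unfolding powr_add[symmetric] by (rule arg_cong[where f = "\<lambda>y. x powr y"]) simp
      then have "g x + x powr (- 1 - a / 2) = g x * (1 + d)"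
        using A by (simp add: g_def d_def distrib_left)
      then have "p * (1 / (g x + x powr (- 1 - a / 2))) powr \<alpha> = p * (1 / (1 + d) / g x) powr \<alpha>"
        by (simp add: mult.commute)
      also have "\<dots> = 2 * x * (1 / (1 + d)) powr \<alpha>" using elim d by (intro g_powr) auto
      also have "(1 / (1 + d)) powr \<alpha> \<le> (1 / (1 + d)) powr 1"
        using d assms by (intro powr_mono') auto
      also have "2 * x * (1 / (1 + d)) powr 1 = 2 * x / (1 + d)" using d by simp
      also have "\<dots> \<le> 2 * x - 2 * ln x" using elim by (simp add: d_def)
      finally show ?case
        using elim by (simp add: psi_power_def exp_div_power2 ennreal_leI)
    qed
    fix c :: real
    have "\<forall>\<^sub>F x in at_top. c * g x \<le> 1" unfolding g_def using a A by real_asymp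
    then show "\<forall>\<^sub>F x in at_top. \<forall>k\<ge>1. 1 / g x \<le> k \<longrightarrow> ennreal (c * k * (g x)\<^sup>2 * exp (2 * x)) \<le> psi_power p \<alpha> k"
      using eventually_gt_at_top[of 1]
    proof eventually_elim
      case (elim x)
      show ?case
      proof (intro allI impI)
        fix k assume k: "1 \<le> k" "1 / g x \<le> k"
        have gx: "0 < g x" using g_pos elim by auto
        define y where "y = k * g x"
        have y: "1 \<le> y" using k gx by (simp add: y_def field_simps)
        \<comment> \<open>The linear growth of the exponent beyond the threshold pays for the extra
          factor \<open>y = k * g x\<close>.\<close>
        have "ln y \<le> 1 * (y - 1)" using y ln_le_minus_one[of y] by simp
        also have "\<dots> \<le> 2 * x * (y - 1)" using y elim by (intro mult_right_mono) auto
        finally have "2 * x + ln y \<le> 2 * x * y powr 1" using y by (simp add: algebra_simps)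
        also have "\<dots> \<le> 2 * x * y powr \<alpha>"
          using y elim assms by (intro mult_left_mono powr_mono) auto
        also have "\<dots> = p * (y / g x) powr \<alpha>" using y elim by (subst g_powr) auto
        also have "y / g x = k" using gx by (simp add: y_def)
        finally show "ennreal (c * k * (g x)\<^sup>2 * exp (2 * x)) \<le> psi_power p \<alpha> k"
          unfolding psi_power_def y_def using gx elim k by (intro ennreal_leI exp_ge_of_log_ge) auto
      qed
    qed
  qed fact
qed

text \<open>Takes the place of exact scaling in the power case. Write k = k0 exp(y). Relative to its
  value at k0 the exponent grows by exp(y) / (ln k / ln k0)^\<beta>. The denominator is at most 1 +
  y/2 because ln k0 \<ge> 2, and exp(y) \<ge> (1 + y/2)^2, so the growth factor is at least 1 + y/2;
  multiplied by s \<ge> 2 it adds at least y.\<close>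

lemma div_ln_powr_growth:
  fixes p \<beta> k0 k s :: real
  assumes "0 < p" "0 < \<beta>" "\<beta> \<le> 1" "0 < k0" "2 \<le> ln k0" "k0 \<le> k" "2 \<le> s"
    and s: "s \<le> p * k0 / ln k0 powr \<beta>"
  shows "s + ln (k / k0) \<le> p * k / ln k powr \<beta>"
proof -
  have "0 < ln k0" using assms(5) by linarith
  then have k0: "1 < k0" using assms(4) by simp
  define y where "y = ln (k / k0)"
  have y: "0 \<le> y" using assms by (simp add: y_def)
  have k: "k = k0 * exp y" using assms by (simp add: y_def)
  have ln_k: "ln k = ln k0 + y" using assms by (simp add: k ln_mult)
  have ln_k_pos: "0 < ln k" using y k0 unfolding ln_k by (simp add: add_pos_nonneg)
  have "(ln k / ln k0) powr \<beta> \<le> (ln k / ln k0) powr 1"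
  proof (rule powr_mono)
    show "1 \<le> ln k / ln k0" using assms(5) y unfolding ln_k by (subst pos_le_divide_eq) auto
  qed (use assms in auto)
  also have "\<dots> = 1 + y / ln k0"
  proof -
    have "(ln k / ln k0) powr 1 = ln k / ln k0" using \<open>0 < ln k0\<close> ln_k_pos by (intro powr_one) auto
    also have "\<dots> = 1 + y / ln k0" using \<open>0 < ln k0\<close> by (simp add: ln_k add_divide_distrib)
    finally show ?thesis .
  qed
  also have "\<dots> \<le> 1 + y / 2" using assms(5) y k0 by (intro add_left_mono divide_left_mono) auto
  finally have q: "(ln k / ln k0) powr \<beta> \<le> 1 + y / 2" .
  have "(1 + y / 2) * (1 + y / 2) \<le> exp y"
  proof -
    have "(1 + y / 2)\<^sup>2 \<le> (exp (y / 2))\<^sup>2" using y by (intro power_mono exp_ge_add_one_self) auto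
    also have "\<dots> = exp y" by (simp flip: exp_double)
    finally show ?thesis by (simp add: power2_eq_square)
  qed
  then have "1 + y / 2 \<le> exp y / (1 + y / 2)" using y by (simp add: pos_le_divide_eq)
  also have "\<dots> \<le> exp y / (ln k / ln k0) powr \<beta>"
    using q y k0 ln_k_pos by (intro divide_left_mono mult_pos_pos) auto
  finally have e: "1 + y / 2 \<le> exp y / (ln k / ln k0) powr \<beta>" .
  have "s + y \<le> s * (1 + y / 2)"
    using mult_right_mono[of 2 s "y / 2"] assms y by (simp add: algebra_simps)
  also have "\<dots> \<le> (p * k0 / ln k0 powr \<beta>) * (exp y / (ln k / ln k0) powr \<beta>)"
    using s e y assms by (intro mult_mono) auto
  also have "\<dots> = p * k / ln k powr \<beta>"
    using k0 y by (simp add: powr_divide ln_k) (simp add: k)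
  finally show ?thesis by (simp add: y_def)
qed

lemma psi_log_asymptotics:
  fixes p \<beta> I :: real
  assumes "0 < I" "0 < p" "0 < \<beta>" "\<beta> \<le> 1"
    and G: "\<forall>\<^sub>F x in at_top. (G has_real_derivative p / 2 / (x * ln x powr \<beta>)) (at x)"
  shows "modulus_asymptotics (psi_log p \<beta>) I (\<lambda>r R. G (ln (1 / r)) - G (ln (1 / R)))"
proof -
  define g where "g x = p / 2 / (x * ln x powr \<beta>)" for x
  define h where "h x = g x - ln x powr (- 1 - \<beta> / 2) / x" for x
  show ?thesis
  \<comment> \<open>\<open>ln (1 / g x)\<close> exceeds \<open>ln x\<close> by about \<open>\<beta> ln (ln x)\<close>, so \<open>\<psi> (1 / g x)\<close> is much smaller than \<open>exp (2 x)\<close>;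
    the relative correction of order \<open>ln x powr (\<beta> / 2 - 1)\<close> in \<open>h\<close> makes up for this\<close>
  proof (rule modulus_asymptoticsI[where hl = g and Hl = G and hu = h and Hu = "\<lambda>x. G x + 2 / \<beta> * ln x powr - (\<beta> / 2)"])
    show "psi_log p \<beta> \<in> borel_measurable borel" unfolding psi_log_def by measurable
    show "g \<in> borel_measurable borel" "h \<in> borel_measurable borel"
      unfolding h_def g_def by measurable
    show "\<forall>\<^sub>F x in at_top. (G has_real_derivative g x) (at x)" using G by (simp add: g_def)
    show "\<forall>\<^sub>F x in at_top. 0 < g x" "\<forall>\<^sub>F x in at_top. g x \<le> 1"
      unfolding g_def using assms(2-4) by real_asymp+
    show h_pos: "\<forall>\<^sub>F x in at_top. 0 < h x"
      unfolding h_def g_def using assms(2-4) by real_asymp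
    show "\<forall>\<^sub>F x in at_top. isCont h x"
      using eventually_gt_at_top[of 1] by eventually_elim (auto simp: h_def[abs_def] g_def[abs_def] intro!: continuous_intros)
    show "((\<lambda>x. G x - G x) \<longlongrightarrow> 0) at_top" by simp
    have "((\<lambda>x. 2 / \<beta> * ln x powr - (\<beta> / 2)) \<longlongrightarrow> 0) at_top" using assms(3) by real_asymp
    then show "((\<lambda>x. G x + 2 / \<beta> * ln x powr - (\<beta> / 2) - G x) \<longlongrightarrow> 0) at_top" by simp
    show "\<forall>\<^sub>F x in at_top. ((\<lambda>x. G x + 2 / \<beta> * ln x powr - (\<beta> / 2)) has_real_derivative h x) (at x)"
      using G eventually_gt_at_top[of 1]
    proof eventually_elim
      case (elim x)
      then have "(G has_real_derivative g x) (at x)" by (simp add: g_def)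
      then show ?case using elim assms(3) by (auto intro!: derivative_eq_intros simp: h_def minus_diff_commute)
    qed
    \<comment> \<open>The exponent at 1/g is \<open>2 * x\<close> times the \<beta>-th power of ln x
      / ln (1/g), hence below \<open>2 * x\<close> by about 2 \<beta>^2 x ln (ln x) / ln x. This far
      exceeds \<open>2 * ln x\<close>, so \<open>g\<close> itself gives the lower bound, while in
      the power case it gives the upper one.\<close>
    have "\<forall>\<^sub>F x in at_top. p * (1 / g x) / ln (1 / g x) powr \<beta> \<le> 2 * x - 2 * ln x"
      "\<forall>\<^sub>F x in at_top. 1 < 1 / g x"
      unfolding g_def using assms(2-4) by real_asymp+
    then show "\<forall>\<^sub>F x in at_top. psi_log p \<beta> (1 / g x) \<le> ennreal (exp (2 * x) / x\<^sup>2)"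
      using eventually_gt_at_top[of 0]
      by eventually_elim (simp add: psi_log_def exp_div_power2 ennreal_leI)
    fix c :: real
    \<comment> \<open>Passing from ln (1/h) to ln x costs a relative error of order ln (ln x) / ln
      x. The correction in \<open>h\<close> contributes about (2/p) (ln x)^(\<beta>/2 - 1), which is
      larger since a positive power of ln x beats ln (ln x).\<close>
    have "\<forall>\<^sub>F x in at_top. 2 * x \<le> p * (1 / h x) / ln (1 / h x) powr \<beta>"
      "\<forall>\<^sub>F x in at_top. c * h x \<le> 1" "\<forall>\<^sub>F x in at_top. 2 \<le> ln (1 / h x)"
      unfolding h_def g_def using assms(2-4) by real_asymp+
    then show "\<forall>\<^sub>F x in at_top. \<forall>k\<ge>1. 1 / h x \<le> k \<longrightarrow> ennreal (c * k * (h x)\<^sup>2 * exp (2 * x)) \<le> psi_log p \<beta> k"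
      using h_pos eventually_gt_at_top[of 1]
    proof eventually_elim
      case (elim x)
      have "2 * x + ln (k * h x) \<le> p * k / ln k powr \<beta>" if "1 / h x \<le> k" for k
        using div_ln_powr_growth[of p \<beta> "1 / h x" k "2 * x"] elim that assms(2-4) by simp
      then show ?case
        using elim by (auto simp: psi_log_def intro!: ennreal_leI exp_ge_of_log_ge)
    qed
  qed fact
qed

section \<open>The four explicit main terms as primitives of the profiles\<close>

theorem corollary10:
  fixes p I :: real
  assumes "0 < I" and "0 < p"
  shows
    "(\<forall>\<alpha>\<ge>1.
        (\<alpha> = 1 \<longrightarrow>
           modulus_asymptotics (psi_power p \<alpha>) I
             (\<lambda>r R. p / 2 * (ln (ln (1 / r)) - ln (ln (1 / R))))) \<and>
        (\<alpha> > 1 \<longrightarrow>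
           modulus_asymptotics (psi_power p \<alpha>) I
             (\<lambda>r R. (p / 2) powr (1 / \<alpha>) * (\<alpha> / (\<alpha> - 1)) *
                (ln (1 / r) powr ((\<alpha> - 1) / \<alpha>) - ln (1 / R) powr ((\<alpha> - 1) / \<alpha>))))) \<and>
     (\<forall>\<beta>. 0 < \<beta> \<and> \<beta> \<le> 1 \<longrightarrow>
        (\<beta> = 1 \<longrightarrow>
           modulus_asymptotics (psi_log p \<beta>) I
             (\<lambda>r R. p / 2 * (ln (ln (ln (1 / r))) - ln (ln (ln (1 / R)))))) \<and>
        (\<beta> < 1 \<longrightarrow>
           modulus_asymptotics (psi_log p \<beta>) I
             (\<lambda>r R. p / (2 * (1 - \<beta>)) *
                (ln (ln (1 / r)) powr (1 - \<beta>) - ln (ln (1 / R)) powr (1 - \<beta>)))))"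
proof (intro conjI allI impI; (elim conjE)?)
  fix \<alpha> :: real assume "1 \<le> \<alpha>" "\<alpha> = 1"
  have "\<forall>\<^sub>F x in at_top. ((\<lambda>x. p / 2 * ln x) has_real_derivative (p / 2) powr (1 / \<alpha>) * x powr - (1 / \<alpha>)) (at x)"
    using eventually_gt_at_top[of 0]
    by eventually_elim (use assms \<open>\<alpha> = 1\<close> in \<open>auto intro!: derivative_eq_intros simp: powr_minus field_simps\<close>)
  from psi_power_asymptotics[OF assms \<open>1 \<le> \<alpha>\<close> this]
  show "modulus_asymptotics (psi_power p \<alpha>) I (\<lambda>r R. p / 2 * (ln (ln (1 / r)) - ln (ln (1 / R))))"
    by (simp only: right_diff_distrib)
next
  fix \<alpha> :: real assume "1 \<le> \<alpha>" "1 < \<alpha>"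
  let ?C = "(p / 2) powr (1 / \<alpha>) * (\<alpha> / (\<alpha> - 1))"
  have "\<forall>\<^sub>F x in at_top. ((\<lambda>x. ?C * x powr ((\<alpha> - 1) / \<alpha>)) has_real_derivative (p / 2) powr (1 / \<alpha>) * x powr - (1 / \<alpha>)) (at x)"
    using eventually_gt_at_top[of 0]
  proof eventually_elim
    case (elim x)
    have e: "(\<alpha> - 1) / \<alpha> - 1 = - (1 / \<alpha>)" using \<open>1 < \<alpha>\<close> by (simp add: field_simps)
    have "((\<lambda>x. ?C * x powr ((\<alpha> - 1) / \<alpha>)) has_real_derivative ?C * ((\<alpha> - 1) / \<alpha> * x powr ((\<alpha> - 1) / \<alpha> - 1))) (at x)"
      using elim by (auto intro!: derivative_eq_intros)
    then show ?case unfolding e using \<open>1 < \<alpha>\<close> by simp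
  qed
  from psi_power_asymptotics[OF assms \<open>1 \<le> \<alpha>\<close> this]
  show "modulus_asymptotics (psi_power p \<alpha>) I
     (\<lambda>r R. ?C * (ln (1 / r) powr ((\<alpha> - 1) / \<alpha>) - ln (1 / R) powr ((\<alpha> - 1) / \<alpha>)))"
    by (simp only: right_diff_distrib)
next
  fix \<beta> :: real assume \<beta>: "\<beta> = 1" "0 < \<beta>" "\<beta> \<le> 1"
  have "\<forall>\<^sub>F x in at_top. ((\<lambda>x. p / 2 * ln (ln x)) has_real_derivative p / 2 / (x * ln x powr \<beta>)) (at x)"
    using eventually_gt_at_top[of 1]
    by eventually_elim (use \<open>\<beta> = 1\<close> in \<open>auto intro!: derivative_eq_intros simp: field_simps\<close>)
  from psi_log_asymptotics[OF assms \<beta>(2,3) this]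
  show "modulus_asymptotics (psi_log p \<beta>) I (\<lambda>r R. p / 2 * (ln (ln (ln (1 / r))) - ln (ln (ln (1 / R)))))"
    by (simp only: right_diff_distrib)
next
  fix \<beta> :: real assume \<beta>: "\<beta> < 1" "0 < \<beta>" "\<beta> \<le> 1"
  let ?C = "p / (2 * (1 - \<beta>))"
  have "\<forall>\<^sub>F x in at_top. ((\<lambda>x. ?C * ln x powr (1 - \<beta>)) has_real_derivative p / 2 / (x * ln x powr \<beta>)) (at x)"
    using eventually_gt_at_top[of 1]
  proof eventually_elim
    case (elim x)
    have "((\<lambda>x. ln x powr (1 - \<beta>)) has_real_derivative (1 - \<beta>) * ln x powr (- \<beta>) * (1 / x)) (at x)"
      using elim by (auto intro!: derivative_eq_intros)
    from DERIV_cmult[OF this, of ?C]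
    have "((\<lambda>x. ?C * ln x powr (1 - \<beta>)) has_real_derivative (?C * (1 - \<beta>)) * (ln x powr (- \<beta>) * (1 / x))) (at x)"
      by (simp only: mult.assoc)
    moreover have "?C * (1 - \<beta>) = p / 2" using \<open>\<beta> < 1\<close> by (simp add: divide_simps)
    moreover have "p / 2 * (ln x powr (- \<beta>) * (1 / x)) = p / 2 / (x * ln x powr \<beta>)"
      by (simp add: powr_minus field_simps)
    ultimately show ?case by (simp only:)
  qed
  from psi_log_asymptotics[OF assms \<beta>(2,3) this]
  show "modulus_asymptotics (psi_log p \<beta>) I
     (\<lambda>r R. ?C * (ln (ln (1 / r)) powr (1 - \<beta>) - ln (ln (1 / R)) powr (1 - \<beta>)))"
    by (simp only: right_diff_distrib)
qed

end
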